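(* Let $(M^n,h)$, $n\ge 3$, be a Riemannian manifold and let $v>0$ be a smooth function on $M$. Set $\hat h:=v^{4/(n-2)}h$ and $f:=2\log v$. Then \[ \operatorname{Ric}_f^{4-n}(\hat h)=\operatorname{Ric}_h-\frac{2v^{-1}\Delta_hv}{n-2}h+\frac{2}{n-2}\left(|\nabla\log v|_h^2h-d\log v\otimes d\log v\right), \] where $|\nabla\log v|_h$ is computed with respect to $h$. In particular, if $\operatorname{Ric}_h\ge 0$ and $\Delta_hv=0$, then \[ \operatorname{Ric}_f^{4-n}(\hat h)\ge\frac{2}{n-2}\left(|\nabla\log v|_h^2h-d\log v\otimes d\log v\right)\ge 0 \] in the sense of symmetric bilinear forms.
   Context: For a Riemannian manifold $(M^n,h)$, $f\in C^\infty(M)$ and $N\in\mathbb R\setminus\{n\}$, the $N$-Bakry--Émery Ricci tensor is \[ \operatorname{Ric}_f^N(h):=\operatorname{Ric}_h+\operatorname{Hess}_hf-\frac{1}{N-n}df\otimes df. \] $\Delta_h$ is the trace of the Hessian $\operatorname{Hess}_h$. *)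

theory Defs
  imports "HOL-Analysis.Analysis"
begin

section \<open>Smooth maps on open sets\<close>

primrec times_differentiable_on ::
    "nat \<Rightarrow> 'a::real_normed_vector set \<Rightarrow> ('a \<Rightarrow> 'b::real_normed_vector) \<Rightarrow> bool" where
  "times_differentiable_on 0 S f \<longleftrightarrow> continuous_on S f"
| "times_differentiable_on (Suc k) S f \<longleftrightarrow>
     (\<forall>x\<in>S. f differentiable (at x)) \<and>
     (\<forall>v. times_differentiable_on k S (\<lambda>x. frechet_derivative f (at x) v))"

text \<open>Only used for open \<open>S\<close>, where \<open>times_differentiable_on k S f\<close> says that \<open>f\<close> is of
  class \<open>C^k\<close> on \<open>S\<close> (finite-dimensional domain).\<close>

definition smooth_on :: "'a::real_normed_vector set \<Rightarrow> ('a \<Rightarrow> 'b::real_normed_vector) \<Rightarrow> bool" where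
  "smooth_on S f \<longleftrightarrow> (\<forall>k. times_differentiable_on k S f)"


section \<open>Smooth manifolds\<close>

text \<open>A chart is a pair of its domain and its coordinate map; the values of the coordinate map
  outside the domain are irrelevant. The dimension is \<open>CARD('n)\<close>.\<close>

type_synonym ('a, 'n) chart = "'a set \<times> ('a \<Rightarrow> real ^ 'n)"

abbreviation chart_dom :: "('a, 'n) chart \<Rightarrow> 'a set" where
  "chart_dom c \<equiv> fst c"

abbreviation coords :: "('a, 'n) chart \<Rightarrow> 'a \<Rightarrow> real ^ 'n" where
  "coords c \<equiv> snd c"

definition chart_inv :: "('a, 'n) chart \<Rightarrow> real ^ 'n \<Rightarrow> 'a" where
  "chart_inv c = inv_into (chart_dom c) (coords c)"

definition transition :: "('a, 'n) chart \<Rightarrow> ('a, 'n) chart \<Rightarrow> real ^ 'n \<Rightarrow> real ^ 'n" where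
  "transition c d = coords d \<circ> chart_inv c"

locale smooth_manifold =
  fixes X :: "'a topology" and A :: "('a, 'n::finite) chart set"
  assumes Hausdorff: "Hausdorff_space X"
    and second_countable: "second_countable X"
    and chart_open: "c \<in> A \<Longrightarrow> openin X (chart_dom c)"
    and chart_image_open: "c \<in> A \<Longrightarrow> open (coords c ` chart_dom c)"
    and chart_homeo: "c \<in> A \<Longrightarrow>
      homeomorphic_map (subtopology X (chart_dom c)) (top_of_set (coords c ` chart_dom c)) (coords c)"
    and charts_cover: "(\<Union>c\<in>A. chart_dom c) = topspace X"
    and transition_smooth: "c \<in> A \<Longrightarrow> d \<in> A \<Longrightarrow>
      smooth_on (coords c ` (chart_dom c \<inter> chart_dom d)) (transition c d)"

definition smooth_function :: "('a, 'n::finite) chart set \<Rightarrow> ('a \<Rightarrow> real) \<Rightarrow> bool" where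
  "smooth_function A u \<longleftrightarrow>
     (\<forall>c\<in>A. smooth_on (coords c ` chart_dom c) (u \<circ> chart_inv c))"


section \<open>Riemannian metrics\<close>

text \<open>A covariant 2-tensor field \<open>T\<close> is represented by its component matrices:
  \<open>T c p $ i $ j\<close> is the value at \<open>p\<close> on the \<open>i\<close>-th and \<open>j\<close>-th coordinate vectors
  of the chart \<open>c\<close>. It is only meaningful for \<open>p \<in> chart_dom c\<close>. Likewise a covector field is
  given by its component vectors.\<close>

type_synonym ('a, 'n) tensor2 = "('a, 'n) chart \<Rightarrow> 'a \<Rightarrow> real ^ 'n ^ 'n"

locale riemannian_manifold = smooth_manifold X A
  for X :: "'a topology" and A :: "('a, 'n::finite) chart set" +
  fixes h :: "('a, 'n) tensor2"
  assumes metric_transform: "c \<in> A \<Longrightarrow> d \<in> A \<Longrightarrow> p \<in> chart_dom c \<inter> chart_dom d \<Longrightarrow>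
      h c p = (let J = matrix (frechet_derivative (transition c d) (at (coords c p)))
               in transpose J ** h d p ** J)"
    and metric_smooth: "c \<in> A \<Longrightarrow>
      smooth_on (coords c ` chart_dom c) (\<lambda>x. h c (chart_inv c x))"
    and metric_sym: "c \<in> A \<Longrightarrow> p \<in> chart_dom c \<Longrightarrow> transpose (h c p) = h c p"
    and metric_pos: "c \<in> A \<Longrightarrow> p \<in> chart_dom c \<Longrightarrow> \<xi> \<noteq> 0 \<Longrightarrow> \<xi> \<bullet> (h c p *v \<xi>) > 0"

text \<open>\<open>form_le S T\<close>: the inequality \<open>S \<le> T\<close> of symmetric bilinear forms, given by their
  matrices in a common basis.\<close>

definition form_le :: "real ^ 'n ^ 'n \<Rightarrow> real ^ 'n ^ 'n \<Rightarrow> bool" where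
  "form_le S T \<longleftrightarrow> (\<forall>\<xi>. \<xi> \<bullet> (S *v \<xi>) \<le> \<xi> \<bullet> (T *v \<xi>))"


section \<open>Curvature and differential operators of a metric\<close>

definition pderiv_at :: "'n::finite \<Rightarrow> (real ^ 'n \<Rightarrow> real) \<Rightarrow> real ^ 'n \<Rightarrow> real" where
  "pderiv_at i u x = frechet_derivative u (at x) (axis i 1)"

text \<open>\<open>christoffel g k i j\<close> is \<open>\<Gamma>\<close> with upper index \<open>k\<close> and lower indices \<open>i\<close>, \<open>j\<close>, for a metric
  \<open>g\<close> on a coordinate domain.\<close>

definition christoffel ::
    "(real ^ 'n \<Rightarrow> real ^ 'n ^ 'n) \<Rightarrow> 'n \<Rightarrow> 'n \<Rightarrow> 'n::finite \<Rightarrow> real ^ 'n \<Rightarrow> real" where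
  "christoffel g k i j x =
     (\<Sum>l\<in>UNIV. matrix_inv (g x) $ k $ l *
        (pderiv_at i (\<lambda>y. g y $ j $ l) x + pderiv_at j (\<lambda>y. g y $ i $ l) x
         - pderiv_at l (\<lambda>y. g y $ i $ j) x)) / 2"

text \<open>\<open>riemann g l k i j\<close> is the component along the \<open>l\<close>-th coordinate vector of
  \<open>R(\<partial>\<^sub>i, \<partial>\<^sub>j) \<partial>\<^sub>k\<close>, with the convention
  \<open>R(X, Y) Z = \<nabla>\<^sub>X \<nabla>\<^sub>Y Z - \<nabla>\<^sub>Y \<nabla>\<^sub>X Z - \<nabla>\<^bsub>[X, Y]\<^esub> Z\<close>.\<close>

definition riemann ::
    "(real ^ 'n \<Rightarrow> real ^ 'n ^ 'n) \<Rightarrow> 'n \<Rightarrow> 'n \<Rightarrow> 'n \<Rightarrow> 'n::finite \<Rightarrow> real ^ 'n \<Rightarrow> real" where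
  "riemann g l k i j x =
     pderiv_at i (christoffel g l j k) x - pderiv_at j (christoffel g l i k) x
     + (\<Sum>m\<in>UNIV. christoffel g m j k x * christoffel g l i m x
                  - christoffel g m i k x * christoffel g l j m x)"

text \<open>\<open>Ric(Y, Z)\<close> is the trace of \<open>X \<mapsto> R(X, Y) Z\<close>; it is positive on round spheres.\<close>

definition ricci :: "('a, 'n::finite) tensor2 \<Rightarrow> ('a, 'n) tensor2" where
  "ricci h c p =
     (\<chi> j k. \<Sum>i\<in>UNIV. riemann (\<lambda>x. h c (chart_inv c x)) i k i j (coords c p))"

definition differential :: "('a \<Rightarrow> real) \<Rightarrow> ('a, 'n::finite) chart \<Rightarrow> 'a \<Rightarrow> real ^ 'n" where
  "differential u c p = (\<chi> i. pderiv_at i (u \<circ> chart_inv c) (coords c p))"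

text \<open>The Hessian is \<open>\<nabla> du\<close>.\<close>

definition hessian :: "('a, 'n::finite) tensor2 \<Rightarrow> ('a \<Rightarrow> real) \<Rightarrow> ('a, 'n) tensor2" where
  "hessian h u c p =
     (\<chi> i j. pderiv_at i (pderiv_at j (u \<circ> chart_inv c)) (coords c p)
       - (\<Sum>k\<in>UNIV. christoffel (\<lambda>x. h c (chart_inv c x)) k i j (coords c p)
                   * differential u c p $ k))"

definition laplacian ::
    "('a, 'n::finite) tensor2 \<Rightarrow> ('a \<Rightarrow> real) \<Rightarrow> ('a, 'n) chart \<Rightarrow> 'a \<Rightarrow> real" where
  "laplacian h u c p = trace (matrix_inv (h c p) ** hessian h u c p)"

definition gradient ::
    "('a, 'n::finite) tensor2 \<Rightarrow> ('a \<Rightarrow> real) \<Rightarrow> ('a, 'n) chart \<Rightarrow> 'a \<Rightarrow> real ^ 'n" where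
  "gradient h u c p = matrix_inv (h c p) *v differential u c p"

definition metric_norm ::
    "('a, 'n::finite) tensor2 \<Rightarrow> ('a, 'n) chart \<Rightarrow> 'a \<Rightarrow> real ^ 'n \<Rightarrow> real" where
  "metric_norm h c p \<xi> = sqrt (\<xi> \<bullet> (h c p *v \<xi>))"

definition tensor_prod :: "real ^ 'n \<Rightarrow> real ^ 'n \<Rightarrow> real ^ 'n ^ 'n" where
  "tensor_prod \<alpha> \<beta> = (\<chi> i j. \<alpha> $ i * \<beta> $ j)"

definition bakry_emery_ricci ::
    "real \<Rightarrow> ('a, 'n::finite) tensor2 \<Rightarrow> ('a \<Rightarrow> real) \<Rightarrow> ('a, 'n) tensor2" where
  "bakry_emery_ricci N h f c p =
     ricci h c p + hessian h f c p
     - (1 / (N - real CARD('n))) *\<^sub>R tensor_prod (differential f c p) (differential f c p)"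

definition conformal_metric ::
    "('a \<Rightarrow> real) \<Rightarrow> ('a, 'n) tensor2 \<Rightarrow> ('a, 'n::finite) tensor2" where
  "conformal_metric w h c p = w p *\<^sub>R h c p"

end

theory Submission
  imports Defs
begin

text \<open>
  Write \<open>\<phi> = 2 / (n - 2) ln v\<close>, so that the conformal metric is \<open>exp (2 \<phi>) h\<close> and
  \<open>f = 2 ln v = (n - 2) \<phi>\<close>. The classical formulas for a conformal change are
  \<^item> \<open>Ric' = Ric - (n - 2) (Hess \<phi> - d\<phi> \<otimes> d\<phi>) - (\<Delta> \<phi> + (n - 2) |d\<phi>|\<^sup>2) h\<close>,
  \<^item> \<open>Hess' f = Hess f - d\<phi> \<otimes> df - df \<otimes> d\<phi> + \<langle>d\<phi>, df\<rangle> h\<close>.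

  For \<open>f = (n - 2) \<phi>\<close> the Hessians cancel in the sum, and so do the terms \<open>(n - 2) |d\<phi>|\<^sup>2 h\<close>. Since
  \<open>N - n = 4 - 2 n\<close>, the Bakry-Emery correction adds \<open>(n - 2) / 2 d\<phi> \<otimes> d\<phi>\<close>, and what is left is
  \<open>Ric - \<Delta> \<phi> h - (n - 2) / 2 d\<phi> \<otimes> d\<phi>\<close>. Expressing \<open>\<Delta> ln v\<close> through \<open>\<Delta> v\<close> gives the stated
  identity; the inequality is then the Cauchy-Schwarz inequality for \<open>h\<close>, applied to a vector and the
  gradient of \<open>ln v\<close>.

  Everything is a pointwise identity in one chart, so the work is done for a matrix-valued function on
  an open subset of \<open>\<real>\<^sup>n\<close> (\<open>coordinate_metric\<close>). The conformal Ricci formula \<open>ricci_ghat\<close> has three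
  ingredients: the change of the Christoffel symbols \<open>christoffel_ghat\<close>; the index algebra
  \<open>christoffel_quadratic_change\<close> for the products of Christoffel symbols; and, for their derivatives,
  metric compatibility \<open>pderiv_metric\<close>, the identity \<open>divergence_local_gradient\<close> between the
  divergence of the gradient and the Laplacian, and the symmetry of mixed partial derivatives. The lemma
  \<open>bakry_emery_local\<close> carries out the cancellation above, and
  \<open>differential_squared_le_gradient\<close> is the final inequality.
\<close>

section \<open>Partial derivatives\<close>

lemma has_derivative_pderiv_at:
  "(u has_derivative D) (at x) \<Longrightarrow> pderiv_at i u x = D (axis i 1)"
  unfolding pderiv_at_def by (metis frechet_derivative_at)

lemma differentiable_has_derivative_at:
  "u differentiable at x \<Longrightarrow> (u has_derivative frechet_derivative u (at x)) (at x)"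
  by (simp add: frechet_derivative_works)

lemma has_derivative_local:
  assumes "open U" "x \<in> U" "\<And>y. y \<in> U \<Longrightarrow> u y = w y"
  shows "(u has_derivative D) (at x) \<longleftrightarrow> (w has_derivative D) (at x)"
  using assms by (metis has_derivative_transform_within_open)

lemma differentiable_local:
  assumes "open U" "x \<in> U" "\<And>y. y \<in> U \<Longrightarrow> u y = w y"
  shows "u differentiable at x \<longleftrightarrow> w differentiable at x"
  unfolding differentiable_def using has_derivative_local[OF assms] by simp

lemma pderiv_at_local:
  assumes "open U" "x \<in> U" "\<And>y. y \<in> U \<Longrightarrow> u y = w y"
  shows "pderiv_at i u x = pderiv_at i w x"
  unfolding pderiv_at_def frechet_derivative_def
  using has_derivative_local[OF assms] by simp

lemma pderiv_at_const: "pderiv_at i (\<lambda>y. c) x = 0"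
  by (simp add: pderiv_at_def)

lemma pderiv_at_add:
  assumes "u differentiable at x" "w differentiable at x"
  shows "pderiv_at i (\<lambda>y. u y + w y) x = pderiv_at i u x + pderiv_at i w x"
  using has_derivative_add[OF assms[THEN differentiable_has_derivative_at]]
  by (subst has_derivative_pderiv_at) (auto simp: pderiv_at_def)

lemma pderiv_at_diff:
  assumes "u differentiable at x" "w differentiable at x"
  shows "pderiv_at i (\<lambda>y. u y - w y) x = pderiv_at i u x - pderiv_at i w x"
  using has_derivative_diff[OF assms[THEN differentiable_has_derivative_at]]
  by (subst has_derivative_pderiv_at) (auto simp: pderiv_at_def)

lemma pderiv_at_mult:
  assumes "u differentiable at x" "w differentiable at x"
  shows "pderiv_at i (\<lambda>y. u y * w y) x = u x * pderiv_at i w x + pderiv_at i u x * w x"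
  using has_derivative_mult[OF assms[THEN differentiable_has_derivative_at]]
  by (subst has_derivative_pderiv_at) (auto simp: pderiv_at_def)

lemma pderiv_at_sum:
  assumes "\<And>a. a \<in> S \<Longrightarrow> u a differentiable at x"
  shows "pderiv_at i (\<lambda>y. \<Sum>a\<in>S. u a y) x = (\<Sum>a\<in>S. pderiv_at i (u a) x)"
  using has_derivative_sum[of S u "\<lambda>a. frechet_derivative (u a) (at x)" "at x",
      OF assms[THEN differentiable_has_derivative_at]]
  by (subst has_derivative_pderiv_at) (auto simp: pderiv_at_def)

lemma pderiv_at_cmult:
  assumes "u differentiable at x"
  shows "pderiv_at i (\<lambda>y. c * u y) x = c * pderiv_at i u x"
  using pderiv_at_mult[of "\<lambda>_. c" x u i] assms by (simp add: pderiv_at_const)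

lemma chain_pderiv_at:
  fixes r :: "real \<Rightarrow> real"
  assumes "u differentiable at x" "(r has_real_derivative d) (at (u x))"
  shows "(\<lambda>y. r (u y)) differentiable at x"
    and "pderiv_at i (\<lambda>y. r (u y)) x = d * pderiv_at i u x"
proof -
  have "((\<lambda>y. r (u y)) has_derivative (\<lambda>z. d * frechet_derivative u (at x) z)) (at x)"
    using has_derivative_compose[OF differentiable_has_derivative_at[OF assms(1)]
        assms(2)[unfolded has_field_derivative_def]] .
  then show "(\<lambda>y. r (u y)) differentiable at x"
    "pderiv_at i (\<lambda>y. r (u y)) x = d * pderiv_at i u x"
    by (auto simp: differentiable_def pderiv_at_def frechet_derivative_at[symmetric])
qed

text \<open>Second derivatives of the metric and of the conformal factor are all that enters the
  curvature. Asking for differentiability of the partials rather than for their continuity lets the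
  differentiation rules alone propagate the condition, and it still implies the symmetry of the mixed
  partials.\<close>

definition twice_differentiable_on :: "(real ^ 'n::finite) set \<Rightarrow> (real ^ 'n \<Rightarrow> real) \<Rightarrow> bool" where
  "twice_differentiable_on U u \<longleftrightarrow>
     (\<forall>x\<in>U. u differentiable at x \<and> (\<forall>i. pderiv_at i u differentiable at x))"

text \<open>The bridge from smooth vector- and matrix-valued maps to their real components, which are their
  images under bounded linear functionals.\<close>

lemma smooth_on_twice_differentiable:
  fixes F :: "real ^ 'n::finite \<Rightarrow> 'b::real_normed_vector" and L :: "'b \<Rightarrow> real"
  assumes "smooth_on U F" "open U" "bounded_linear L"
  shows "twice_differentiable_on U (\<lambda>y. L (F y))"
proof -
  have "times_differentiable_on (Suc (Suc 0)) U F"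
    using assms by (simp add: smooth_on_def del: times_differentiable_on.simps)
  then have F: "\<And>x. x \<in> U \<Longrightarrow> F differentiable at x"
    and dF: "\<And>x v. x \<in> U \<Longrightarrow> (\<lambda>y. frechet_derivative F (at y) v) differentiable at x"
    by auto
  have D: "((\<lambda>y. L (F y)) has_derivative (\<lambda>v. L (frechet_derivative F (at x) v))) (at x)" if "x \<in> U" for x
    using F[OF that] assms(3) by (simp add: bounded_linear.has_derivative frechet_derivative_works)
  have "pderiv_at i (\<lambda>y. L (F y)) differentiable at x" if "x \<in> U" for x i
  proof -
    have "(\<lambda>y. L (frechet_derivative F (at y) (axis i 1))) differentiable at x"
      using bounded_linear.has_derivative[OF assms(3)] dF[OF that, of "axis i 1"]
      unfolding differentiable_def by blast
    then show ?thesis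
      using differentiable_local[OF \<open>open U\<close> that, of "pderiv_at i (\<lambda>y. L (F y))"
          "\<lambda>y. L (frechet_derivative F (at y) (axis i 1))"] has_derivative_pderiv_at[OF D] by simp
  qed
  then show ?thesis
    using D by (auto simp: twice_differentiable_on_def differentiable_def)
qed

lemma pderiv_at_ln:
  assumes "u differentiable at x" "u x > 0"
  shows "(\<lambda>y. ln (u y)) differentiable at x"
    and "pderiv_at i (\<lambda>y. ln (u y)) x = pderiv_at i u x / u x"
  using chain_pderiv_at[OF assms(1) DERIV_ln[OF assms(2)]]
  by (auto simp: inverse_eq_divide)

lemma twice_differentiable_ln:
  assumes "open U" and u: "twice_differentiable_on U u" and pos: "\<And>x. x \<in> U \<Longrightarrow> u x > 0"
  shows "twice_differentiable_on U (\<lambda>y. ln (u y))"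
  unfolding twice_differentiable_on_def
proof (intro ballI conjI allI)
  fix x i assume x: "x \<in> U"
  have du: "u differentiable at y" if "y \<in> U" for y
    using u that by (simp add: twice_differentiable_on_def)
  show "(\<lambda>y. ln (u y)) differentiable at x"
    by (rule pderiv_at_ln) (simp_all add: x du pos)
  have "(\<lambda>y. pderiv_at i u y / u y) differentiable at x"
    using u x pos[OF x] by (intro differentiable_divide) (auto simp: twice_differentiable_on_def)
  then show "pderiv_at i (\<lambda>y. ln (u y)) differentiable at x"
    using differentiable_local[OF \<open>open U\<close> x, of "pderiv_at i (\<lambda>y. ln (u y))" "\<lambda>y. pderiv_at i u y / u y"]
    by (simp add: pderiv_at_ln du pos)
qed

lemma pderiv_at_cmult_on:
  assumes "open U" "twice_differentiable_on U u" "x \<in> U"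
  shows "pderiv_at i (\<lambda>y. c * u y) x = c * pderiv_at i u x"
    and "pderiv_at j (pderiv_at i (\<lambda>y. c * u y)) x = c * pderiv_at j (pderiv_at i u) x"
    and "pderiv_at i (\<lambda>y. c * u y) differentiable at x"
proof -
  have *: "pderiv_at i (\<lambda>y. c * u y) y = c * pderiv_at i u y" if "y \<in> U" for y
    using assms(2) that by (simp add: pderiv_at_cmult twice_differentiable_on_def)
  show "pderiv_at i (\<lambda>y. c * u y) x = c * pderiv_at i u x" using * assms(3) .
  have d: "pderiv_at i u differentiable at x" using assms(2,3) by (simp add: twice_differentiable_on_def)
  have "pderiv_at j (pderiv_at i (\<lambda>y. c * u y)) x = pderiv_at j (\<lambda>y. c * pderiv_at i u y) x"
    by (rule pderiv_at_local[OF assms(1,3) *])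
  then show "pderiv_at j (pderiv_at i (\<lambda>y. c * u y)) x = c * pderiv_at j (pderiv_at i u) x"
    by (simp add: pderiv_at_cmult d)
  show "pderiv_at i (\<lambda>y. c * u y) differentiable at x"
    using differentiable_local[OF assms(1,3) *] d by simp
qed

lemma twice_differentiable_cmult:
  assumes "open U" "twice_differentiable_on U u"
  shows "twice_differentiable_on U (\<lambda>y. c * u y)"
  using assms pderiv_at_cmult_on(3)[OF assms] by (auto simp: twice_differentiable_on_def)

section \<open>Young's theorem on mixed partial derivatives\<close>

text \<open>The second difference of \<open>u\<close> along the square spanned by \<open>s e\<^sub>i\<close> and \<open>s e\<^sub>j\<close> is symmetric in
  \<open>i\<close> and \<open>j\<close>, yet it is asymptotic to \<open>s\<^sup>2\<close> times one particular mixed partial derivative. The mean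
  value theorem in direction \<open>e\<^sub>i\<close> turns it into \<open>s\<close> times a first difference of \<open>\<partial>\<^sub>i u\<close>,
  and differentiability of \<open>\<partial>\<^sub>i u\<close> at the single point \<open>x\<close> evaluates that difference.\<close>

lemma second_difference_quotient:
  fixes u :: "real ^ 'n::finite \<Rightarrow> real"
  assumes U: "open U" "x \<in> U" and du: "\<And>y. y \<in> U \<Longrightarrow> u differentiable at y"
    and ddu: "pderiv_at i u differentiable at x" and "\<epsilon> > 0"
  obtains \<delta> where "\<delta> > 0" and "\<And>s. 0 < s \<Longrightarrow> s < \<delta> \<Longrightarrow>
      \<bar>(u (x + s *\<^sub>R axis i 1 + s *\<^sub>R axis j 1) - u (x + s *\<^sub>R axis i 1)
         - u (x + s *\<^sub>R axis j 1) + u x) - s\<^sup>2 * pderiv_at j (pderiv_at i u) x\<bar> \<le> \<epsilon> * s\<^sup>2"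
proof -
  let ?a = "axis i 1 :: real ^ 'n" and ?b = "axis j 1 :: real ^ 'n"
  define A where "A = pderiv_at i u"
  define A' where "A' = frechet_derivative A (at x)"
  have A': "(A has_derivative A') (at x)"
    using ddu by (simp add: A_def A'_def differentiable_has_derivative_at)
  then interpret A': bounded_linear A'
    by (rule has_derivative_bounded_linear)
  have ppd: "pderiv_at j (pderiv_at i u) x = A' ?b"
    by (simp add: A_def A'_def pderiv_at_def)
  obtain r where r: "r > 0" "ball x r \<subseteq> U"
    using U open_contains_ball by blast
  have "\<epsilon> / 3 > 0" using \<open>\<epsilon> > 0\<close> by simp
  then obtain d where d: "d > 0" "\<And>y. norm (y - x) < d \<Longrightarrow>
      norm (A y - A x - A' (y - x)) \<le> \<epsilon> / 3 * norm (y - x)"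
    using A' unfolding has_derivative_at_alt by blast
  \<comment> \<open>The error of the linear approximation of \<open>\<partial>\<^sub>i u\<close> at \<open>x\<close>. Evaluated at two points of norm at most \<open>2 s\<close> and \<open>s\<close>, it accounts for the factor \<open>\<epsilon> / 3\<close>.\<close>
  define rem where "rem z = A (x + z) - A x - A' z" for z
  have rem: "\<bar>rem z\<bar> \<le> \<epsilon> / 3 * norm z" if "norm z < d" for z
    using d(2)[of "x + z"] that by (simp add: rem_def)
  show thesis
  proof
    show "min r d / 2 > 0" using r d by simp
    fix s :: real assume s: "0 < s" "s < min r d / 2"
    have nrm: "norm (t *\<^sub>R ?a + k *\<^sub>R ?b) \<le> t + k" if "0 \<le> t" "0 \<le> k" for t k
      using norm_triangle_ineq[of "t *\<^sub>R ?a" "k *\<^sub>R ?b"] that by simp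
    have inU: "x + t *\<^sub>R ?a + k *\<^sub>R ?b \<in> U" if "0 \<le> t" "t \<le> s" "0 \<le> k" "k \<le> s" for t k
    proof -
      have "norm (t *\<^sub>R ?a + k *\<^sub>R ?b) < r"
        using nrm[of t k] that s by linarith
      then have "x + (t *\<^sub>R ?a + k *\<^sub>R ?b) \<in> ball x r"
        by (simp only: mem_ball dist_norm norm_minus_commute[of x] add_diff_cancel_left')
      then show ?thesis using r by (auto simp only: add.assoc)
    qed
    define \<psi> where "\<psi> t = u (x + t *\<^sub>R ?a + s *\<^sub>R ?b) - u (x + t *\<^sub>R ?a)" for t
    \<comment> \<open>Stated for general \<open>k\<close>, since the first difference uses it with \<open>k = s\<close> and with \<open>k = 0\<close>.\<close>
    have der1: "((\<lambda>t. u (x + t *\<^sub>R ?a + k *\<^sub>R ?b)) has_real_derivative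
        A (x + t *\<^sub>R ?a + k *\<^sub>R ?b)) (at t)" if "0 \<le> t" "t \<le> s" "0 \<le> k" "k \<le> s" for t k
    proof -
      let ?y = "x + t *\<^sub>R ?a + k *\<^sub>R ?b"
      have du': "(u has_derivative frechet_derivative u (at ?y)) (at ?y)"
        using du[OF inU[OF that]] by (rule differentiable_has_derivative_at)
      interpret D: bounded_linear "frechet_derivative u (at ?y)"
        using du' by (rule has_derivative_bounded_linear)
      have "((\<lambda>t. x + t *\<^sub>R ?a + k *\<^sub>R ?b) has_derivative (\<lambda>t. t *\<^sub>R ?a)) (at t)"
        by (auto intro!: derivative_eq_intros)
      from has_derivative_compose[OF this du'] show ?thesis
        by (simp add: has_field_derivative_def D.scaleR A_def pderiv_at_def
            mult.commute[of "frechet_derivative u (at ?y) ?a"] mult_commute_abs)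
    qed
    have der: "(\<psi> has_real_derivative A (x + t *\<^sub>R ?a + s *\<^sub>R ?b) - A (x + t *\<^sub>R ?a)) (at t)"
      if "0 \<le> t" "t \<le> s" for t
      unfolding \<psi>_def using der1[of t s] der1[of t 0] that s by (auto intro!: DERIV_diff)
    obtain \<theta> where \<theta>: "0 < \<theta>" "\<theta> < s"
      and mvt: "\<psi> s - \<psi> 0 = (s - 0) * (A (x + \<theta> *\<^sub>R ?a + s *\<^sub>R ?b) - A (x + \<theta> *\<^sub>R ?a))"
      using MVT2[of 0 s \<psi> "\<lambda>t. A (x + t *\<^sub>R ?a + s *\<^sub>R ?b) - A (x + t *\<^sub>R ?a)"] s der by blast
    define z where "z = \<theta> *\<^sub>R ?a + s *\<^sub>R ?b"
    have nz: "norm z \<le> 2 * s" "norm z < d" and n\<theta>: "norm (\<theta> *\<^sub>R ?a) \<le> s" "norm (\<theta> *\<^sub>R ?a) < d"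
      using nrm[of \<theta> s] nrm[of \<theta> 0] \<theta> s by (auto simp: z_def)
    have incr: "A (x + \<theta> *\<^sub>R ?a + s *\<^sub>R ?b) - A (x + \<theta> *\<^sub>R ?a) = s * A' ?b + (rem z - rem (\<theta> *\<^sub>R ?a))"
      by (simp add: rem_def z_def A'.add A'.scaleR add.assoc)
    have "\<bar>rem z - rem (\<theta> *\<^sub>R ?a)\<bar> \<le> \<epsilon> * s"
    proof -
      have "\<bar>rem z\<bar> \<le> \<epsilon> / 3 * (2 * s)" 
        by (rule order_trans[OF rem[OF nz(2)]]) (use nz \<open>\<epsilon> > 0\<close> in \<open>intro mult_left_mono, auto\<close>)
      moreover have "\<bar>rem (\<theta> *\<^sub>R ?a)\<bar> \<le> \<epsilon> / 3 * s" 
        by (rule order_trans[OF rem[OF n\<theta>(2)]]) (use n\<theta> \<open>\<epsilon> > 0\<close> in \<open>intro mult_left_mono, auto\<close>)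
      ultimately show ?thesis by argo
    qed
    then have "\<bar>s * (rem z - rem (\<theta> *\<^sub>R ?a))\<bar> \<le> s * (\<epsilon> * s)"
      using s by (simp only: abs_mult) (intro mult_mono, auto)
    moreover have "\<psi> s - \<psi> 0 - s\<^sup>2 * A' ?b = s * (rem z - rem (\<theta> *\<^sub>R ?a))"
      unfolding mvt incr by (simp add: power2_eq_square ring_distribs)
    ultimately have "\<bar>\<psi> s - \<psi> 0 - s\<^sup>2 * A' ?b\<bar> \<le> \<epsilon> * s\<^sup>2"
      by (simp only: power2_eq_square mult_ac)
    then show "\<bar>(u (x + s *\<^sub>R ?a + s *\<^sub>R ?b) - u (x + s *\<^sub>R ?a) - u (x + s *\<^sub>R ?b) + u x)
         - s\<^sup>2 * pderiv_at j (pderiv_at i u) x\<bar> \<le> \<epsilon> * s\<^sup>2"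
      by (simp add: \<psi>_def ppd diff_diff_eq2 add.commute)
  qed
qed

text \<open>Young's form of the symmetry of second derivatives: both mixed partials are the limit of the
  same second difference quotient. The Ricci tensor of the conformal metric needs it, because the
  formula for the Christoffel symbols yields \<open>\<partial>\<^sub>j \<partial>\<^sub>k \<phi>\<close> and \<open>\<partial>\<^sub>k \<partial>\<^sub>j \<phi>\<close> in an asymmetric way.\<close>

lemma mixed_pderiv_at_commute:
  fixes u :: "real ^ 'n::finite \<Rightarrow> real"
  assumes U: "open U" "x \<in> U" and du: "\<And>y. y \<in> U \<Longrightarrow> u differentiable at y"
    and ddu: "\<And>i. pderiv_at i u differentiable at x"
  shows "pderiv_at j (pderiv_at i u) x = pderiv_at i (pderiv_at j u) x"
proof -
  let ?p = "pderiv_at j (pderiv_at i u) x" and ?q = "pderiv_at i (pderiv_at j u) x"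
  have "\<bar>?p - ?q\<bar> \<le> 0 + e" if "e > 0" for e
  proof -
    have e: "e / 2 > 0" using that by simp
    obtain d1 where d1: "d1 > 0" "\<And>s. 0 < s \<Longrightarrow> s < d1 \<Longrightarrow>
      \<bar>(u (x + s *\<^sub>R axis i 1 + s *\<^sub>R axis j 1) - u (x + s *\<^sub>R axis i 1)
         - u (x + s *\<^sub>R axis j 1) + u x) - s\<^sup>2 * ?p\<bar> \<le> e / 2 * s\<^sup>2"
      using second_difference_quotient[OF U du ddu e] by blast
    obtain d2 where d2: "d2 > 0" "\<And>s. 0 < s \<Longrightarrow> s < d2 \<Longrightarrow>
      \<bar>(u (x + s *\<^sub>R axis j 1 + s *\<^sub>R axis i 1) - u (x + s *\<^sub>R axis j 1)
         - u (x + s *\<^sub>R axis i 1) + u x) - s\<^sup>2 * ?q\<bar> \<le> e / 2 * s\<^sup>2"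
      using second_difference_quotient[OF U du ddu e] by blast
    define s where "s = min d1 d2 / 2"
    have s: "0 < s" "s < d1" "s < d2" using d1 d2 by (auto simp: s_def)
    define \<Delta> where "\<Delta> = u (x + s *\<^sub>R axis i 1 + s *\<^sub>R axis j 1) - u (x + s *\<^sub>R axis i 1)
         - u (x + s *\<^sub>R axis j 1) + u x"
    have "\<bar>\<Delta> - s\<^sup>2 * ?p\<bar> \<le> e / 2 * s\<^sup>2"
      using d1(2)[OF s(1,2)] by (simp add: \<Delta>_def)
    moreover have "u (x + s *\<^sub>R axis j 1 + s *\<^sub>R axis i 1) - u (x + s *\<^sub>R axis j 1)
         - u (x + s *\<^sub>R axis i 1) + u x = \<Delta>"
      by (simp add: \<Delta>_def add.assoc add.commute[of "s *\<^sub>R axis j 1"])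
    then have "\<bar>\<Delta> - s\<^sup>2 * ?q\<bar> \<le> e / 2 * s\<^sup>2"
      using d2(2)[OF s(1,3)] by simp
    ultimately have "\<bar>s\<^sup>2 * ?p - s\<^sup>2 * ?q\<bar> \<le> e * s\<^sup>2"
      by linarith
    then have "s\<^sup>2 * \<bar>?p - ?q\<bar> \<le> s\<^sup>2 * e"
      by (simp add: abs_mult mult.commute flip: right_diff_distrib)
    then show ?thesis using s by (simp add: mult_le_cancel_left)
  qed
  then have "\<bar>?p - ?q\<bar> \<le> 0" by (rule field_le_epsilon)
  then show ?thesis by simp
qed

section \<open>The inverse matrix\<close>

lemma matrix_inv_right_left:
  fixes M :: "real ^ 'n::finite ^ 'n"
  assumes "invertible M"
  shows "M ** matrix_inv M = mat 1" "matrix_inv M ** M = mat 1"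
proof -
  have "M ** matrix_inv M = mat 1 \<and> matrix_inv M ** M = mat 1"
    unfolding matrix_inv_def by (rule someI_ex) (use assms in \<open>simp add: invertible_def\<close>)
  then show "M ** matrix_inv M = mat 1" "matrix_inv M ** M = mat 1" by auto
qed

lemma matrix_inv_unique:
  fixes M N :: "real ^ 'n::finite ^ 'n"
  assumes "M ** N = mat 1" "N ** M = mat 1"
  shows "matrix_inv M = N"
  by (metis assms invertible_def matrix_inv_right_left(2) matrix_mul_assoc matrix_mul_lid
      matrix_mul_rid)

text \<open>Cramer's rule writes the entries of the inverse as quotients of polynomials in the entries,
  which is how they inherit differentiability.\<close>

lemma matrix_inv_entry:
  fixes M :: "real ^ 'n::finite ^ 'n"
  assumes "invertible M"
  shows "matrix_inv M $ k $ l = det (\<chi> i j. if j = k then axis l 1 $ i else M $ i $ j) / det M"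
proof -
  have "M *v (matrix_inv M *v axis l 1) = axis l 1"
    using matrix_inv_right_left[OF assms] by (simp add: matrix_vector_mul_assoc)
  moreover have "det M \<noteq> 0" using assms by (simp add: invertible_det_nz)
  ultimately have "matrix_inv M *v axis l 1 =
      (\<chi> k. det (\<chi> i j. if j = k then axis l 1 $ i else M $ i $ j) / det M)"
    using cramer by blast
  then have "(matrix_inv M *v axis l 1) $ k =
      det (\<chi> i j. if j = k then axis l 1 $ i else M $ i $ j) / det M" by simp
  then show ?thesis by (simp add: matrix_vector_mul_component inner_axis)
qed

lemma differentiable_det:
  fixes M :: "'a::real_normed_vector \<Rightarrow> real ^ 'n::finite ^ 'n"
  assumes "\<And>i j. (\<lambda>y. M y $ i $ j) differentiable at x"
  shows "(\<lambda>y. det (M y)) differentiable at x"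
proof -
  have "(\<lambda>y. \<Prod>i\<in>S. M y $ i $ p i) differentiable at x" for S and p :: "'n \<Rightarrow> 'n"
    by (induction S rule: infinite_finite_induct) (auto intro!: assms differentiable_mult)
  then show ?thesis unfolding det_def by (intro differentiable_sum differentiable_mult) auto
qed

lemma differentiable_matrix_inv:
  fixes M :: "'a::real_normed_vector \<Rightarrow> real ^ 'n::finite ^ 'n"
  assumes "open U" "x \<in> U" "\<And>y. y \<in> U \<Longrightarrow> invertible (M y)"
    and M: "\<And>i j. (\<lambda>y. M y $ i $ j) differentiable at x"
  shows "(\<lambda>y. matrix_inv (M y) $ k $ l) differentiable at x"
proof -
  have "(\<lambda>y. det (\<chi> i j. if j = k then axis l 1 $ i else M y $ i $ j) / det (M y)) differentiable at x"
  proof (intro differentiable_divide differentiable_det)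
    show "(\<lambda>y. (\<chi> i j. if j = k then axis l 1 $ i else M y $ i $ j) $ i $ j) differentiable at x" for i j
      using M by (cases "j = k") auto
    show "det (M x) \<noteq> 0" using assms by (simp flip: invertible_det_nz)
  qed (rule M)
  then show ?thesis
    using differentiable_local[OF assms(1,2)] matrix_inv_entry[OF assms(3)] by (metis (no_types, lifting))
qed

section \<open>A metric on a coordinate domain\<close>

text \<open>The Hessian, gradient and Laplacian of a function on a coordinate domain, componentwise and
  without reference to a chart, so that they can be differentiated as functions of the coordinates.\<close>

definition local_hessian ::
    "(real ^ 'n \<Rightarrow> real ^ 'n ^ 'n) \<Rightarrow> (real ^ 'n::finite \<Rightarrow> real) \<Rightarrow> 'n \<Rightarrow> 'n \<Rightarrow> real ^ 'n \<Rightarrow> real" where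
  "local_hessian g u i j x =
     pderiv_at i (pderiv_at j u) x - (\<Sum>k\<in>UNIV. christoffel g k i j x * pderiv_at k u x)"

definition local_gradient ::
    "(real ^ 'n \<Rightarrow> real ^ 'n ^ 'n) \<Rightarrow> (real ^ 'n::finite \<Rightarrow> real) \<Rightarrow> 'n \<Rightarrow> real ^ 'n \<Rightarrow> real" where
  "local_gradient g u k x = (\<Sum>l\<in>UNIV. matrix_inv (g x) $ k $ l * pderiv_at l u x)"

definition local_laplacian ::
    "(real ^ 'n \<Rightarrow> real ^ 'n ^ 'n) \<Rightarrow> (real ^ 'n::finite \<Rightarrow> real) \<Rightarrow> real ^ 'n \<Rightarrow> real" where
  "local_laplacian g u x =
     (\<Sum>i\<in>UNIV. \<Sum>j\<in>UNIV. matrix_inv (g x) $ i $ j * local_hessian g u j i x)"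

text \<open>The setting for connection and curvature: \<open>g\<close> is the matrix of a metric in coordinates that
  range over \<open>U\<close>, so that all identities below hold between honest functions on an open set and may
  be differentiated.\<close>

locale coordinate_metric =
  fixes U :: "(real ^ 'n::finite) set" and g :: "real ^ 'n \<Rightarrow> real ^ 'n ^ 'n"
  assumes open_U: "open U"
    and invertible_g: "x \<in> U \<Longrightarrow> invertible (g x)"
    and g_sym: "x \<in> U \<Longrightarrow> g x $ i $ j = g x $ j $ i"
    and g_diff2: "twice_differentiable_on U (\<lambda>y. g y $ i $ j)"
begin

lemma g_differentiable: "x \<in> U \<Longrightarrow> (\<lambda>y. g y $ i $ j) differentiable at x"
  using g_diff2 by (simp add: twice_differentiable_on_def)

lemma pderiv_g_differentiable: "x \<in> U \<Longrightarrow> pderiv_at k (\<lambda>y. g y $ i $ j) differentiable at x"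
  using g_diff2 by (simp add: twice_differentiable_on_def)

lemma pderiv_g_sym: "x \<in> U \<Longrightarrow> pderiv_at k (\<lambda>y. g y $ i $ j) x = pderiv_at k (\<lambda>y. g y $ j $ i) x"
  by (rule pderiv_at_local[OF open_U]) (auto intro: g_sym)

lemma inv_differentiable: "x \<in> U \<Longrightarrow> (\<lambda>y. matrix_inv (g y) $ k $ l) differentiable at x"
  by (rule differentiable_matrix_inv[OF open_U]) (auto intro: g_differentiable invertible_g)

lemma inv_mult_g:
  "x \<in> U \<Longrightarrow> (\<Sum>l\<in>UNIV. matrix_inv (g x) $ k $ l * g x $ l $ j) = (if k = j then 1 else 0)"
  using matrix_inv_right_left(2)[OF invertible_g, of x]
  by (simp add: matrix_matrix_mult_def mat_def vec_eq_iff)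

lemma g_mult_inv:
  "x \<in> U \<Longrightarrow> (\<Sum>l\<in>UNIV. g x $ k $ l * matrix_inv (g x) $ l $ j) = (if k = j then 1 else 0)"
  using matrix_inv_right_left(1)[OF invertible_g, of x]
  by (simp add: matrix_matrix_mult_def mat_def vec_eq_iff)

lemma inv_sym:
  assumes "x \<in> U" shows "matrix_inv (g x) $ i $ j = matrix_inv (g x) $ j $ i"
proof -
  have t: "transpose (g x) = g x"
    using g_sym[OF assms] by (simp add: transpose_def vec_eq_iff)
  have "transpose (matrix_inv (g x)) ** g x = mat 1" "g x ** transpose (matrix_inv (g x)) = mat 1"
    using matrix_inv_right_left[OF invertible_g[OF assms]]
    by (metis matrix_transpose_mul t transpose_mat)+
  then have "matrix_inv (g x) = transpose (matrix_inv (g x))"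
    by (intro matrix_inv_unique)
  from arg_cong[OF this, of "\<lambda>M. M $ i $ j"] show ?thesis
    by (simp add: transpose_def)
qed

lemma g_inv_cancel:
  assumes "x \<in> U"
  shows "(\<Sum>k\<in>UNIV. g x $ m $ k * (\<Sum>l\<in>UNIV. matrix_inv (g x) $ k $ l * F l)) = F m"
proof -
  have "(\<Sum>k\<in>UNIV. g x $ m $ k * (\<Sum>l\<in>UNIV. matrix_inv (g x) $ k $ l * F l))
      = (\<Sum>l\<in>UNIV. (\<Sum>k\<in>UNIV. g x $ m $ k * matrix_inv (g x) $ k $ l) * F l)"
    by (simp add: sum_distrib_left sum_distrib_right mult.assoc) (rule sum.swap)
  also have "\<dots> = F m"
    by (simp add: g_mult_inv[OF assms] if_distrib[of "\<lambda>t. t * _"] cong: if_cong)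
  finally show ?thesis .
qed

lemma christoffel_sym: "x \<in> U \<Longrightarrow> christoffel g k i j x = christoffel g k j i x"
  unfolding christoffel_def using pderiv_g_sym[of x _ i j] by (simp add: add.commute)

text \<open>Lowering the upper index cancels the inverse matrix and leaves the first-order expression that
  defines the Christoffel symbols of the first kind.\<close>

lemma christoffel_lowered:
  assumes "x \<in> U"
  shows "(\<Sum>k\<in>UNIV. g x $ m $ k * christoffel g k i j x) =
     (pderiv_at i (\<lambda>y. g y $ j $ m) x + pderiv_at j (\<lambda>y. g y $ i $ m) x
         - pderiv_at m (\<lambda>y. g y $ i $ j) x) / 2"
  unfolding christoffel_def times_divide_eq_right sum_divide_distrib[symmetric]
  by (subst g_inv_cancel[OF assms]) simp

text \<open>Compatibility of the Levi-Civita connection with the metric, \<open>\<nabla> g = 0\<close>, in coordinates: two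
  Christoffel symbols of the first kind add up so that all but one derivative of \<open>g\<close> cancels.\<close>

lemma pderiv_metric:
  assumes "x \<in> U"
  shows "pderiv_at i (\<lambda>y. g y $ j $ k) x =
     (\<Sum>m\<in>UNIV. g x $ k $ m * christoffel g m i j x) + (\<Sum>m\<in>UNIV. g x $ j $ m * christoffel g m i k x)"
  unfolding christoffel_lowered[OF assms]
  using pderiv_g_sym[OF assms] by (simp add: field_simps)

lemma christoffel_differentiable: "x \<in> U \<Longrightarrow> christoffel g k i j differentiable at x"
proof -
  assume x: "x \<in> U"
  have "(\<lambda>x. christoffel g k i j x) differentiable at x"
    unfolding christoffel_def divide_inverse
    by (intro differentiable_mult differentiable_sum ballI differentiable_add differentiable_diff
        inv_differentiable[OF x] pderiv_g_differentiable[OF x] differentiable_const) auto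
  then show ?thesis by simp
qed

context
  fixes u :: "real ^ 'n \<Rightarrow> real"
  assumes u: "twice_differentiable_on U u"
begin

lemma u_differentiable: "x \<in> U \<Longrightarrow> u differentiable at x"
  and pderiv_u_differentiable: "x \<in> U \<Longrightarrow> pderiv_at i u differentiable at x"
  using u by (auto simp: twice_differentiable_on_def)

lemma local_gradient_differentiable: "x \<in> U \<Longrightarrow> local_gradient g u k differentiable at x"
proof -
  assume x: "x \<in> U"
  have "(\<lambda>x. local_gradient g u k x) differentiable at x"
    unfolding local_gradient_def
    by (intro differentiable_mult differentiable_sum ballI
        inv_differentiable[OF x] pderiv_u_differentiable[OF x]) auto
  then show ?thesis by simp
qed

lemma g_mult_local_gradient:
  "x \<in> U \<Longrightarrow> (\<Sum>k\<in>UNIV. g x $ j $ k * local_gradient g u k x) = pderiv_at j u x"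
  unfolding local_gradient_def by (rule g_inv_cancel)

text \<open>The divergence of the gradient is the trace of the Hessian. Differentiating
  \<open>\<partial>\<^sub>i u = \<Sum>\<^sub>m g\<^sub>i\<^sub>m u\<^sup>m\<close> and replacing the derivative of \<open>g\<close> by means of metric compatibility
  avoids any formula for the derivative of the inverse metric.\<close>

lemma divergence_local_gradient:
  assumes x: "x \<in> U"
  shows "(\<Sum>k\<in>UNIV. pderiv_at k (local_gradient g u k) x)
       + (\<Sum>i\<in>UNIV. \<Sum>m\<in>UNIV. christoffel g i i m x * local_gradient g u m x)
       = local_laplacian g u x"
proof -
  let ?I = "\<lambda>i j. matrix_inv (g x) $ i $ j" and ?P = "\<lambda>k. local_gradient g u k x"
  let ?G = "\<lambda>k i j. christoffel g k i j x"
  \<comment> \<open>The last sum carries what remains of the derivative of \<open>g\<close> after the Christoffel term of the Hessian has been split off.\<close>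
  have second: "pderiv_at j (pderiv_at i u) x = (\<Sum>m\<in>UNIV. g x $ i $ m * pderiv_at j (local_gradient g u m) x)
      + (\<Sum>a\<in>UNIV. ?G a j i * pderiv_at a u x) + (\<Sum>m\<in>UNIV. \<Sum>a\<in>UNIV. g x $ i $ a * ?G a j m * ?P m)" for i j
  proof -
    have "pderiv_at j (pderiv_at i u) x = pderiv_at j (\<lambda>y. \<Sum>m\<in>UNIV. g y $ i $ m * local_gradient g u m y) x"
      by (rule pderiv_at_local[OF open_U x]) (simp add: g_mult_local_gradient)
    also have "\<dots> = (\<Sum>m\<in>UNIV. g x $ i $ m * pderiv_at j (local_gradient g u m) x
                       + pderiv_at j (\<lambda>y. g y $ i $ m) x * ?P m)"
      using g_differentiable[OF x] local_gradient_differentiable[OF x]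
      by (subst pderiv_at_sum) (auto intro!: differentiable_mult simp: pderiv_at_mult)
    also have "\<dots> = (\<Sum>m\<in>UNIV. g x $ i $ m * pderiv_at j (local_gradient g u m) x)
        + (\<Sum>m\<in>UNIV. \<Sum>a\<in>UNIV. ?G a j i * (g x $ a $ m * ?P m))
        + (\<Sum>m\<in>UNIV. \<Sum>a\<in>UNIV. g x $ i $ a * ?G a j m * ?P m)"
      unfolding pderiv_metric[OF x] distrib_right sum.distrib sum_distrib_right
      by (simp only: g_sym[OF x] mult_ac add_ac)
    also have "(\<Sum>m\<in>UNIV. \<Sum>a\<in>UNIV. ?G a j i * (g x $ a $ m * ?P m)) = (\<Sum>a\<in>UNIV. ?G a j i * pderiv_at a u x)"
      by (subst sum.swap) (simp add: g_mult_local_gradient[OF x] flip: sum_distrib_left)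
    finally show ?thesis .
  qed
  have hess: "local_hessian g u j i x = (\<Sum>m\<in>UNIV. g x $ i $ m * pderiv_at j (local_gradient g u m) x)
      + (\<Sum>m\<in>UNIV. \<Sum>a\<in>UNIV. g x $ i $ a * ?G a j m * ?P m)" for i j
    by (simp add: local_hessian_def second)
  have "(\<Sum>i\<in>UNIV. \<Sum>j\<in>UNIV. ?I i j * local_hessian g u j i x)
      = (\<Sum>i\<in>UNIV. \<Sum>j\<in>UNIV. ?I i j * (\<Sum>m\<in>UNIV. g x $ i $ m * pderiv_at j (local_gradient g u m) x))
      + (\<Sum>i\<in>UNIV. \<Sum>j\<in>UNIV. ?I i j * (\<Sum>m\<in>UNIV. \<Sum>a\<in>UNIV. g x $ i $ a * ?G a j m * ?P m))"
    by (simp add: hess distrib_left sum.distrib)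
  also have "(\<Sum>i\<in>UNIV. \<Sum>j\<in>UNIV. ?I i j * (\<Sum>m\<in>UNIV. g x $ i $ m * pderiv_at j (local_gradient g u m) x))
     = (\<Sum>j\<in>UNIV. pderiv_at j (local_gradient g u j) x)"
  proof -
    have "(\<Sum>i\<in>UNIV. ?I i j * (\<Sum>m\<in>UNIV. g x $ i $ m * F m)) = F j" for j and F :: "'n \<Rightarrow> real"
    proof -
      have "(\<Sum>i\<in>UNIV. ?I i j * (\<Sum>m\<in>UNIV. g x $ i $ m * F m)) = (\<Sum>m\<in>UNIV. (\<Sum>i\<in>UNIV. ?I j i * g x $ i $ m) * F m)"
        by (simp add: sum_distrib_left sum_distrib_right mult.assoc inv_sym[OF x, of _ j]) (rule sum.swap)
      also have "\<dots> = F j"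
        by (simp add: inv_mult_g[OF x] if_distrib[of "\<lambda>t. t * _"] cong: if_cong)
      finally show ?thesis .
    qed
    then show ?thesis by (subst sum.swap) simp
  qed
  also have "(\<Sum>i\<in>UNIV. \<Sum>j\<in>UNIV. ?I i j * (\<Sum>m\<in>UNIV. \<Sum>a\<in>UNIV. g x $ i $ a * ?G a j m * ?P m))
     = (\<Sum>i\<in>UNIV. \<Sum>m\<in>UNIV. ?G i i m * ?P m)"
  proof -
    have "(\<Sum>i\<in>UNIV. ?I i j * (\<Sum>m\<in>UNIV. \<Sum>a\<in>UNIV. g x $ i $ a * ?G a j m * ?P m)) = (\<Sum>m\<in>UNIV. ?G j j m * ?P m)" for j
    proof -
      have "(\<Sum>i\<in>UNIV. ?I i j * (\<Sum>m\<in>UNIV. \<Sum>a\<in>UNIV. g x $ i $ a * ?G a j m * ?P m))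
        = (\<Sum>i\<in>UNIV. \<Sum>a\<in>UNIV. ?I j i * g x $ i $ a * (\<Sum>m\<in>UNIV. ?G a j m * ?P m))"
        by (subst sum.swap) (simp add: sum_distrib_left mult.assoc inv_sym[OF x, of _ j])
      also have "\<dots> = (\<Sum>a\<in>UNIV. (\<Sum>i\<in>UNIV. ?I j i * g x $ i $ a) * (\<Sum>m\<in>UNIV. ?G a j m * ?P m))"
        by (subst sum.swap) (simp add: sum_distrib_right)
      also have "\<dots> = (\<Sum>m\<in>UNIV. ?G j j m * ?P m)"
        by (simp add: inv_mult_g[OF x] if_distrib[of "\<lambda>t. t * _"] cong: if_cong)
      finally show ?thesis .
    qed
    then show ?thesis by (subst sum.swap) simp
  qed
  finally show ?thesis by (simp add: local_laplacian_def)
qed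

end
end

section \<open>Conformal change in coordinates\<close>

text \<open>The quadratic part of the Ricci tensor under a change \<open>G + D\<close> of Christoffel symbols, where \<open>D\<close>
  is the difference of the Levi-Civita connections of two conformal metrics, \<open>p\<close> plays the part of
  \<open>d\<phi>\<close> and \<open>P\<close> that of its gradient. It is pure index algebra at a point. The products of \<open>p\<close> with a
  trace of \<open>G\<close> cancel between the two products; the last two sums are kept because they are
  what metric compatibility gives for the derivative of the metric along the gradient.\<close>

lemma christoffel_quadratic_change:
  fixes G D :: "'n::finite \<Rightarrow> 'n \<Rightarrow> 'n \<Rightarrow> real" and p P :: "'n \<Rightarrow> real" and g :: "'n \<Rightarrow> 'n \<Rightarrow> real"
  assumes D: "\<And>k i j. D k i j = (if k = i then p j else 0) + (if k = j then p i else 0) - g i j * P k"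
    and lower: "\<And>j. (\<Sum>m\<in>UNIV. g j m * P m) = p j"
    and gsym: "\<And>i j. g i j = g j i" and Gsym: "\<And>k i j. G k i j = G k j i"
  shows "(\<Sum>i\<in>UNIV. \<Sum>m\<in>UNIV. (G m j k + D m j k) * (G i i m + D i i m))
       - (\<Sum>i\<in>UNIV. \<Sum>m\<in>UNIV. (G m i k + D m i k) * (G i j m + D i j m))
     = (\<Sum>i\<in>UNIV. \<Sum>m\<in>UNIV. G m j k * G i i m) - (\<Sum>i\<in>UNIV. \<Sum>m\<in>UNIV. G m i k * G i j m)
       + (real CARD('n) - 2) * ((\<Sum>m\<in>UNIV. G m j k * p m) + p j * p k - g j k * (\<Sum>m\<in>UNIV. P m * p m))
       - g j k * (\<Sum>i\<in>UNIV. \<Sum>m\<in>UNIV. G i i m * P m)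
       + (\<Sum>i\<in>UNIV. \<Sum>m\<in>UNIV. G m i k * g j m * P i)
       + (\<Sum>i\<in>UNIV. \<Sum>m\<in>UNIV. G m i j * g k m * P i)"
proof -
  let ?n = "real CARD('n)" and ?N = "\<Sum>m\<in>UNIV. P m * p m"
  \<comment> \<open>Each of the next local facts contracts one factor \<open>D\<close>; applied repeatedly, they evaluate all products that contain \<open>D\<close>.\<close>
  have trace: "(\<Sum>i\<in>UNIV. D i i m) = ?n * p m" for m
  proof -
    have "(\<Sum>i\<in>UNIV. D i i m) = ?n * p m + p m - (\<Sum>i\<in>UNIV. g m i * P i)"
      by (simp add: D sum.distrib sum_subtractf gsym[of _ m])
    then show ?thesis by (simp add: lower)
  qed
  have upper: "(\<Sum>m\<in>UNIV. S m * D m i l) = p l * S i + p i * S l - g i l * (\<Sum>m\<in>UNIV. P m * S m)"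
    for i l and S :: "'n \<Rightarrow> real"
  proof -
    have "(\<Sum>m\<in>UNIV. S m * D m i l) = (\<Sum>m\<in>UNIV. (if m = i then S m * p l else 0)
        + (if m = l then S m * p i else 0) - g i l * (P m * S m))"
      by (rule sum.cong) (auto simp: D algebra_simps)
    then show ?thesis
      by (simp add: sum.distrib sum_subtractf mult.commute flip: sum_distrib_left)
  qed
  have cross: "(\<Sum>i\<in>UNIV. \<Sum>m\<in>UNIV. T m i * D i j m) =
      (\<Sum>m\<in>UNIV. T m j * p m) + p j * (\<Sum>m\<in>UNIV. T m m) - (\<Sum>i\<in>UNIV. \<Sum>m\<in>UNIV. T m i * g j m * P i)"
    for T :: "'n \<Rightarrow> 'n \<Rightarrow> real"
  proof -
    have "(\<Sum>i\<in>UNIV. \<Sum>m\<in>UNIV. T m i * D i j m) = (\<Sum>m\<in>UNIV. \<Sum>i\<in>UNIV. T m i * D i j m)"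
      by (rule sum.swap)
    also have "\<dots> = (\<Sum>m\<in>UNIV. p m * T m j + p j * T m m - (\<Sum>i\<in>UNIV. T m i * g j m * P i))"
      by (simp add: upper sum_distrib_left mult_ac)
    also have "\<dots> = (\<Sum>m\<in>UNIV. p m * T m j) + p j * (\<Sum>m\<in>UNIV. T m m) - (\<Sum>m\<in>UNIV. \<Sum>i\<in>UNIV. T m i * g j m * P i)"
      by (simp add: sum.distrib sum_subtractf sum_distrib_left)
    finally show ?thesis
      by (subst sum.swap) (simp add: mult.commute)
  qed
  have tr: "(\<Sum>i\<in>UNIV. \<Sum>m\<in>UNIV. T m * D i i m) = ?n * (\<Sum>m\<in>UNIV. T m * p m)" for T :: "'n \<Rightarrow> real"
    by (subst sum.swap) (simp add: trace sum_distrib_left[symmetric] sum_distrib_left mult_ac)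
  have 1: "(\<Sum>i\<in>UNIV. \<Sum>m\<in>UNIV. D m j k * G i i m) =
      p k * (\<Sum>i\<in>UNIV. G i i j) + p j * (\<Sum>i\<in>UNIV. G i i k) - g j k * (\<Sum>i\<in>UNIV. \<Sum>m\<in>UNIV. G i i m * P m)"
    using upper[of "G i i" j k for i]
    by (simp add: mult.commute[of "D _ _ _"] sum.distrib sum_subtractf mult.commute[of "P _"] flip: sum_distrib_left)
  have Dp: "(\<Sum>m\<in>UNIV. D m j k * p m) = 2 * p j * p k - g j k * ?N"
    using upper[of p j k] by (simp add: mult.commute[of "D _ _ _"])
  have 2: "(\<Sum>i\<in>UNIV. \<Sum>m\<in>UNIV. D m i k * G i j m) =
      p k * (\<Sum>i\<in>UNIV. G i i j) + (\<Sum>m\<in>UNIV. G m j k * p m) - (\<Sum>i\<in>UNIV. \<Sum>m\<in>UNIV. G m i j * g k m * P i)"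
  proof -
    have "(\<Sum>i\<in>UNIV. \<Sum>m\<in>UNIV. D m i k * G i j m)
        = (\<Sum>i\<in>UNIV. p k * G i j i + p i * G i j k - (\<Sum>m\<in>UNIV. g i k * (P m * G i j m)))"
      using upper[of "G i j" i k for i] by (simp add: mult.commute[of "D _ _ _"] sum_distrib_left)
    also have "\<dots> = p k * (\<Sum>i\<in>UNIV. G i j i) + (\<Sum>i\<in>UNIV. p i * G i j k) - (\<Sum>i\<in>UNIV. \<Sum>m\<in>UNIV. g i k * (P m * G i j m))"
      by (simp add: sum.distrib sum_subtractf sum_distrib_left)
    also have "(\<Sum>i\<in>UNIV. \<Sum>m\<in>UNIV. g i k * (P m * G i j m)) = (\<Sum>m\<in>UNIV. \<Sum>i\<in>UNIV. g i k * (P m * G i j m))"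
      by (rule sum.swap)
    finally show ?thesis
      by (simp add: Gsym[of _ j] gsym[of k] mult_ac)
  qed
  have 3: "(\<Sum>i\<in>UNIV. \<Sum>m\<in>UNIV. D m i k * g j m * P i) = g j k * ?N"
  proof -
    have "(\<Sum>m\<in>UNIV. D m i k * g j m * P i) = (p k * g j i + p i * g j k - g i k * p j) * P i" for i
    proof -
      have "(\<Sum>m\<in>UNIV. D m i k * g j m * P i) = (\<Sum>m\<in>UNIV. g j m * D m i k) * P i"
        unfolding sum_distrib_right by (intro sum.cong) (simp_all only: mult.commute)
      also have "(\<Sum>m\<in>UNIV. g j m * D m i k) = p k * g j i + p i * g j k - g i k * p j"
        unfolding upper by (simp add: lower[symmetric] mult.commute)
      finally show ?thesis .
    qed
    then have "(\<Sum>i\<in>UNIV. \<Sum>m\<in>UNIV. D m i k * g j m * P i)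
       = (\<Sum>i\<in>UNIV. (p k * g j i + p i * g j k - g i k * p j) * P i)"
      by simp
    also have "\<dots> = (\<Sum>i\<in>UNIV. p k * (g j i * P i) + g j k * (P i * p i) - p j * (g k i * P i))"
      by (intro sum.cong) (simp_all add: algebra_simps gsym[of _ k])
    also have "\<dots> = p k * p j + g j k * ?N - p j * p k"
      by (simp add: sum.distrib sum_subtractf lower flip: sum_distrib_left)
    finally show ?thesis by simp
  qed
  have A: "(\<Sum>i\<in>UNIV. \<Sum>m\<in>UNIV. (G m j k + D m j k) * (G i i m + D i i m)) =
      (\<Sum>i\<in>UNIV. \<Sum>m\<in>UNIV. G m j k * G i i m) + ?n * (\<Sum>m\<in>UNIV. G m j k * p m)
      + (p k * (\<Sum>i\<in>UNIV. G i i j) + p j * (\<Sum>i\<in>UNIV. G i i k) - g j k * (\<Sum>i\<in>UNIV. \<Sum>m\<in>UNIV. G i i m * P m))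
      + ?n * (2 * p j * p k - g j k * ?N)"
    unfolding distrib_left distrib_right sum.distrib tr 1 Dp by simp
  have B: "(\<Sum>i\<in>UNIV. \<Sum>m\<in>UNIV. (G m i k + D m i k) * (G i j m + D i j m)) =
      (\<Sum>i\<in>UNIV. \<Sum>m\<in>UNIV. G m i k * G i j m)
      + ((\<Sum>m\<in>UNIV. G m j k * p m) + p j * (\<Sum>m\<in>UNIV. G m m k) - (\<Sum>i\<in>UNIV. \<Sum>m\<in>UNIV. G m i k * g j m * P i))
      + (p k * (\<Sum>i\<in>UNIV. G i i j) + (\<Sum>m\<in>UNIV. G m j k * p m) - (\<Sum>i\<in>UNIV. \<Sum>m\<in>UNIV. G m i j * g k m * P i))
      + (2 * p j * p k - g j k * ?N + p j * (?n * p k) - g j k * ?N)"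
    unfolding distrib_left distrib_right sum.distrib 2 cross[of "\<lambda>m i. G m i k"] cross[of "\<lambda>m i. D m i k"] trace Dp 3
    by simp
  show ?thesis unfolding A B by (simp add: algebra_simps)
qed

lemma riemann_trace:
  "(\<Sum>i\<in>UNIV. riemann g i k i j x) =
     (\<Sum>i\<in>UNIV. pderiv_at i (christoffel g i j k) x)
   - (\<Sum>i\<in>UNIV. pderiv_at j (christoffel g i i k) x)
   + (\<Sum>i\<in>UNIV. \<Sum>m\<in>UNIV. christoffel g m j k x * christoffel g i i m x)
   - (\<Sum>i\<in>UNIV. \<Sum>m\<in>UNIV. christoffel g m i k x * christoffel g i j m x)"
  by (simp add: riemann_def sum.distrib sum_subtractf)

locale conformal_change = coordinate_metric U g
  for U :: "(real ^ 'n::finite) set" and g :: "real ^ 'n \<Rightarrow> real ^ 'n ^ 'n" +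
  fixes \<phi> :: "real ^ 'n \<Rightarrow> real" and ghat :: "real ^ 'n \<Rightarrow> real ^ 'n ^ 'n"
  assumes \<phi>: "twice_differentiable_on U \<phi>"
    and ghat: "x \<in> U \<Longrightarrow> ghat x = exp (2 * \<phi> x) *\<^sub>R g x"
begin

lemma pderiv_ghat:
  assumes x: "x \<in> U"
  shows "pderiv_at k (\<lambda>y. ghat y $ i $ j) x =
    exp (2 * \<phi> x) * (pderiv_at k (\<lambda>y. g y $ i $ j) x + 2 * pderiv_at k \<phi> x * g x $ i $ j)"
proof -
  have "((\<lambda>t. exp (2 * t)) has_real_derivative 2 * exp (2 * \<phi> x)) (at (\<phi> x))"
    by (auto intro!: derivative_eq_intros)
  note e = chain_pderiv_at[OF u_differentiable[OF \<phi> x] this]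
  have "pderiv_at k (\<lambda>y. ghat y $ i $ j) x = pderiv_at k (\<lambda>y. exp (2 * \<phi> y) * g y $ i $ j) x"
    by (rule pderiv_at_local[OF open_U x]) (simp add: ghat)
  also have "\<dots> = exp (2 * \<phi> x) * pderiv_at k (\<lambda>y. g y $ i $ j) x + 2 * exp (2 * \<phi> x) * pderiv_at k \<phi> x * g x $ i $ j"
    by (subst pderiv_at_mult[OF e(1) g_differentiable[OF x]]) (simp add: e(2))
  finally show ?thesis by (simp add: algebra_simps)
qed

lemma inv_ghat:
  assumes x: "x \<in> U"
  shows "matrix_inv (ghat x) = exp (- 2 * \<phi> x) *\<^sub>R matrix_inv (g x)"
proof (rule matrix_inv_unique)
  have "exp (2 * \<phi> x) * exp (- 2 * \<phi> x) = 1" by (simp flip: exp_add)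
  then show "ghat x ** exp (- 2 * \<phi> x) *\<^sub>R matrix_inv (g x) = mat 1"
    "(exp (- 2 * \<phi> x) *\<^sub>R matrix_inv (g x)) ** ghat x = mat 1"
    using matrix_inv_right_left[OF invertible_g[OF x]]
    by (simp_all add: ghat x matrix_scalar_ac scalar_matrix_assoc[symmetric] mult.commute)
qed

text \<open>The derivative of the factor \<open>exp (2 \<phi>)\<close> contributes \<open>2 \<partial>\<^sub>k \<phi> g\<^sub>i\<^sub>j\<close> to each derivative of the
  metric, and the factor itself cancels against the one of the inverse metric.\<close>

lemma christoffel_ghat:
  assumes x: "x \<in> U"
  shows "christoffel ghat k i j x = christoffel g k i j x +
    ((if k = i then pderiv_at j \<phi> x else 0) + (if k = j then pderiv_at i \<phi> x else 0)
       - g x $ i $ j * local_gradient g \<phi> k x)"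
proof -
  let ?I = "\<lambda>l. matrix_inv (g x) $ k $ l" and ?p = "\<lambda>i. pderiv_at i \<phi> x"
  let ?S = "\<lambda>l. pderiv_at i (\<lambda>y. g y $ j $ l) x + pderiv_at j (\<lambda>y. g y $ i $ l) x - pderiv_at l (\<lambda>y. g y $ i $ j) x"
  have e: "exp (- 2 * \<phi> x) * exp (2 * \<phi> x) = 1" by (simp flip: exp_add)
  have "christoffel ghat k i j x = (\<Sum>l\<in>UNIV. (exp (- 2 * \<phi> x) * exp (2 * \<phi> x)) * (?I l *
      (?S l + 2 * (?p i * g x $ j $ l + ?p j * g x $ i $ l - ?p l * g x $ i $ j)))) / 2"
    unfolding christoffel_def inv_ghat[OF x] pderiv_ghat[OF x]
    by (intro arg_cong[of _ _ "\<lambda>t. t / 2"] sum.cong) (simp_all add: algebra_simps)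
  also have "\<dots> = (\<Sum>l\<in>UNIV. ?I l * ?S l / 2 + ((?I l * g x $ l $ j) * ?p i + (?I l * g x $ l $ i) * ?p j
        - g x $ i $ j * (?I l * ?p l)))"
    unfolding e sum_divide_distrib
    by (intro sum.cong) (simp_all add: g_sym[OF x] field_simps)
  also have "\<dots> = christoffel g k i j x + ((if k = j then 1 else 0) * ?p i + (if k = i then 1 else 0) * ?p j
        - g x $ i $ j * local_gradient g \<phi> k x)"
    unfolding sum.distrib sum_subtractf sum_distrib_right[symmetric] sum_distrib_left[symmetric] inv_mult_g[OF x]
    by (simp add: christoffel_def local_gradient_def sum_divide_distrib)
  finally show ?thesis by simp
qed

lemma local_hessian_ghat:
  assumes x: "x \<in> U"
  shows "local_hessian ghat u i j x = local_hessian g u i j x - pderiv_at i \<phi> x * pderiv_at j u x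
    - pderiv_at j \<phi> x * pderiv_at i u x + g x $ i $ j * (\<Sum>k\<in>UNIV. local_gradient g \<phi> k x * pderiv_at k u x)"
proof -
  have "(\<Sum>k\<in>UNIV. christoffel ghat k i j x * pderiv_at k u x) =
     (\<Sum>k\<in>UNIV. christoffel g k i j x * pderiv_at k u x
       + ((if k = i then pderiv_at j \<phi> x * pderiv_at k u x else 0) + (if k = j then pderiv_at i \<phi> x * pderiv_at k u x else 0)
       - g x $ i $ j * (local_gradient g \<phi> k x * pderiv_at k u x)))"
    by (intro sum.cong) (simp_all add: christoffel_ghat[OF x] algebra_simps)
  then show ?thesis
    by (simp add: local_hessian_def sum.distrib sum_subtractf flip: sum_distrib_left)
qed

text \<open>The classical formula for the Ricci tensor of \<open>exp (2 \<phi>) g\<close>. With \<open>D\<close> the change of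
  the Christoffel symbols, the linear part contributes the derivatives of \<open>D\<close>, the quadratic part
  the products with \<open>D\<close>. The derivatives of \<open>g\<close> along the gradient of \<open>\<phi>\<close> cancel against
  the corresponding products by metric compatibility, and the derivatives of the gradient combine with
  the traced Christoffel symbols to the divergence of the gradient, which is the Laplacian.\<close>

lemma ricci_ghat:
  assumes x: "x \<in> U"
  shows "(\<Sum>i\<in>UNIV. riemann ghat i k i j x) = (\<Sum>i\<in>UNIV. riemann g i k i j x)
    - (real CARD('n) - 2) * (local_hessian g \<phi> j k x - pderiv_at j \<phi> x * pderiv_at k \<phi> x)
    - (local_laplacian g \<phi> x
       + (real CARD('n) - 2) * (\<Sum>m\<in>UNIV. local_gradient g \<phi> m x * pderiv_at m \<phi> x)) * g x $ j $ k"
proof -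
  define D where "D k i j y = (if k = i then pderiv_at j \<phi> y else 0) + (if k = j then pderiv_at i \<phi> y else 0)
       - g y $ i $ j * local_gradient g \<phi> k y" for k i j y
  let ?p = "\<lambda>i. pderiv_at i \<phi> x" and ?P = "\<lambda>i. local_gradient g \<phi> i x"
  let ?G = "\<lambda>k i j. christoffel g k i j x" and ?n = "real CARD('n)"
  have \<Gamma>: "christoffel ghat k i j y = christoffel g k i j y + D k i j y" if "y \<in> U" for k i j y
    by (simp add: christoffel_ghat[OF that] D_def)
  note d = g_differentiable[OF x] local_gradient_differentiable[OF \<phi> x] pderiv_u_differentiable[OF \<phi> x]
  have delta: "(\<lambda>y. if b then w y else 0) differentiable at x"
    "pderiv_at i (\<lambda>y. if b then w y else 0) x = (if b then pderiv_at i w x else 0)"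
    if "w differentiable at x" for b i and w :: "real ^ 'n \<Rightarrow> real"
    using that by (cases b; simp add: pderiv_at_const)+
  have D_diff: "D k i j differentiable at x" for k i j
  proof -
    have "(\<lambda>y. D k i j y) differentiable at x"
      unfolding D_def by (intro differentiable_add differentiable_diff differentiable_mult delta d)
    then show ?thesis by simp
  qed
  have dD: "pderiv_at l (D k i j) x = (if k = i then pderiv_at l (pderiv_at j \<phi>) x else 0)
      + (if k = j then pderiv_at l (pderiv_at i \<phi>) x else 0)
      - (g x $ i $ j * pderiv_at l (local_gradient g \<phi> k) x + pderiv_at l (\<lambda>y. g y $ i $ j) x * ?P k)" for l k i j
  proof -
    have "pderiv_at l (\<lambda>y. D k i j y) x = (if k = i then pderiv_at l (pderiv_at j \<phi>) x else 0)
      + (if k = j then pderiv_at l (pderiv_at i \<phi>) x else 0)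
      - (g x $ i $ j * pderiv_at l (local_gradient g \<phi> k) x + pderiv_at l (\<lambda>y. g y $ i $ j) x * ?P k)"
      unfolding D_def
      by (simp only: pderiv_at_diff pderiv_at_add pderiv_at_mult differentiable_add differentiable_mult delta d)
    then show ?thesis by simp
  qed
  have d\<Gamma>: "pderiv_at l (christoffel ghat k i j) x = pderiv_at l (christoffel g k i j) x + pderiv_at l (D k i j) x" for l k i j
  proof -
    have "pderiv_at l (christoffel ghat k i j) x = pderiv_at l (\<lambda>y. christoffel g k i j y + D k i j y) x"
      by (rule pderiv_at_local[OF open_U x]) (simp add: \<Gamma>)
    then show ?thesis
      by (simp add: pderiv_at_add[OF christoffel_differentiable[OF x] D_diff])
  qed
  have symm: "pderiv_at k (pderiv_at j \<phi>) x = pderiv_at j (pderiv_at k \<phi>) x"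
    by (rule mixed_pderiv_at_commute[OF open_U x]) (auto intro: u_differentiable[OF \<phi>] d)
  have div1: "(\<Sum>i\<in>UNIV. pderiv_at i (D i j k) x) = 2 * pderiv_at j (pderiv_at k \<phi>) x
      - g x $ j $ k * (\<Sum>i\<in>UNIV. pderiv_at i (local_gradient g \<phi> i) x)
      - (\<Sum>i\<in>UNIV. pderiv_at i (\<lambda>y. g y $ j $ k) x * ?P i)"
    by (simp add: dD sum.distrib sum_subtractf symm flip: sum_distrib_left)
  \<comment> \<open>The trace of \<open>D\<close> is \<open>n d\<phi>\<close> on all of \<open>U\<close>, so it can be differentiated as such.\<close>
  have div2: "(\<Sum>i\<in>UNIV. pderiv_at j (D i i k) x) = ?n * pderiv_at j (pderiv_at k \<phi>) x"
  proof -
    have "(\<Sum>i\<in>UNIV. D i i k y) = ?n * pderiv_at k \<phi> y" if "y \<in> U" for y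
    proof -
      have "(\<Sum>i\<in>UNIV. D i i k y) = ?n * pderiv_at k \<phi> y + pderiv_at k \<phi> y
          - (\<Sum>i\<in>UNIV. g y $ k $ i * local_gradient g \<phi> i y)"
        by (simp add: D_def sum.distrib sum_subtractf g_sym[OF that, of _ k])
      then show ?thesis by (simp add: g_mult_local_gradient[OF \<phi> that])
    qed
    then have "pderiv_at j (\<lambda>y. \<Sum>i\<in>UNIV. D i i k y) x = pderiv_at j (\<lambda>y. ?n * pderiv_at k \<phi> y) x"
      by (intro pderiv_at_local[OF open_U x])
    then show ?thesis
      by (simp add: pderiv_at_sum[OF D_diff] pderiv_at_cmult[OF d(3)])
  qed
  have dg: "(\<Sum>i\<in>UNIV. pderiv_at i (\<lambda>y. g y $ j $ k) x * ?P i) =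
      (\<Sum>i\<in>UNIV. \<Sum>m\<in>UNIV. ?G m i k * g x $ j $ m * ?P i) + (\<Sum>i\<in>UNIV. \<Sum>m\<in>UNIV. ?G m i j * g x $ k $ m * ?P i)"
    unfolding pderiv_metric[OF x] distrib_right sum.distrib sum_distrib_right
    by (simp only: mult_ac add_ac)
  have quad: "(\<Sum>i\<in>UNIV. \<Sum>m\<in>UNIV. christoffel ghat m j k x * christoffel ghat i i m x)
       - (\<Sum>i\<in>UNIV. \<Sum>m\<in>UNIV. christoffel ghat m i k x * christoffel ghat i j m x)
     = (\<Sum>i\<in>UNIV. \<Sum>m\<in>UNIV. ?G m j k * ?G i i m) - (\<Sum>i\<in>UNIV. \<Sum>m\<in>UNIV. ?G m i k * ?G i j m)
       + (?n - 2) * ((\<Sum>m\<in>UNIV. ?G m j k * ?p m) + ?p j * ?p k - g x $ j $ k * (\<Sum>m\<in>UNIV. ?P m * ?p m))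
       - g x $ j $ k * (\<Sum>i\<in>UNIV. \<Sum>m\<in>UNIV. ?G i i m * ?P m)
       + (\<Sum>i\<in>UNIV. \<Sum>m\<in>UNIV. ?G m i k * g x $ j $ m * ?P i)
       + (\<Sum>i\<in>UNIV. \<Sum>m\<in>UNIV. ?G m i j * g x $ k $ m * ?P i)"
    unfolding \<Gamma>[OF x]
    by (rule christoffel_quadratic_change[of "\<lambda>k i j. D k i j x" ?p "\<lambda>i j. g x $ i $ j" ?P ?G])
       (auto simp: D_def g_mult_local_gradient[OF \<phi> x] g_sym[OF x] christoffel_sym[OF x])
  show ?thesis
    unfolding riemann_trace d\<Gamma> sum.distrib div1 div2 dg local_hessian_def[of g \<phi> j k]
      divergence_local_gradient[OF \<phi> x, symmetric]
    using quad by (simp add: algebra_simps)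
qed

end

section \<open>The Bakry-Emery tensor in coordinates\<close>

context coordinate_metric
begin

lemma local_hessian_cmult:
  assumes "twice_differentiable_on U u" "x \<in> U"
  shows "local_hessian g (\<lambda>y. c * u y) i j x = c * local_hessian g u i j x"
  unfolding local_hessian_def pderiv_at_cmult_on[OF open_U assms]
  by (simp add: algebra_simps sum_distrib_left)

lemma local_laplacian_cmult:
  assumes "twice_differentiable_on U u" "x \<in> U"
  shows "local_laplacian g (\<lambda>y. c * u y) x = c * local_laplacian g u x"
  unfolding local_laplacian_def local_hessian_cmult[OF assms]
  by (simp add: algebra_simps sum_distrib_left)

lemma local_gradient_cmult:
  assumes "twice_differentiable_on U u" "x \<in> U"
  shows "local_gradient g (\<lambda>y. c * u y) k x = c * local_gradient g u k x"
  unfolding local_gradient_def pderiv_at_cmult_on[OF open_U assms]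
  by (simp add: algebra_simps sum_distrib_left)

text \<open>The Christoffel term is linear in the first derivatives and is just divided by \<open>u\<close>; the product
  of differentials comes from differentiating the factor \<open>1 / u\<close> in \<open>\<partial>\<^sub>j (ln u) = \<partial>\<^sub>j u / u\<close>.\<close>

lemma local_hessian_ln:
  assumes u: "twice_differentiable_on U u" and pos: "\<And>x. x \<in> U \<Longrightarrow> u x > 0" and x: "x \<in> U"
  shows "local_hessian g (\<lambda>y. ln (u y)) i j x = local_hessian g u i j x / u x
    - pderiv_at i (\<lambda>y. ln (u y)) x * pderiv_at j (\<lambda>y. ln (u y)) x"
proof -
  note du = u_differentiable[OF u] and ddu = pderiv_u_differentiable[OF u]
  have "u x \<noteq> 0" using pos[OF x] by simp
  then have "((\<lambda>t. inverse t) has_real_derivative - (inverse (u x) ^ Suc (Suc 0))) (at (u x))"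
    by (rule DERIV_inverse)
  note inv = chain_pderiv_at[OF du[OF x] this]
  have "pderiv_at i (pderiv_at j (\<lambda>y. ln (u y))) x = pderiv_at i (\<lambda>y. pderiv_at j u y * inverse (u y)) x"
    by (rule pderiv_at_local[OF open_U x]) (simp add: pderiv_at_ln du pos divide_inverse)
  also have "\<dots> = pderiv_at i (pderiv_at j u) x / u x - pderiv_at i u x / u x * (pderiv_at j u x / u x)"
    by (simp add: pderiv_at_mult ddu[OF x] inv divide_inverse)
  finally show ?thesis
    by (simp add: local_hessian_def pderiv_at_ln du pos x diff_divide_distrib sum_divide_distrib)
qed

lemma local_laplacian_ln:
  assumes u: "twice_differentiable_on U u" and pos: "\<And>x. x \<in> U \<Longrightarrow> u x > 0" and x: "x \<in> U"
  shows "local_laplacian g (\<lambda>y. ln (u y)) x = local_laplacian g u x / u x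
    - (\<Sum>m\<in>UNIV. local_gradient g (\<lambda>y. ln (u y)) m x * pderiv_at m (\<lambda>y. ln (u y)) x)"
proof -
  let ?w = "\<lambda>y. ln (u y)"
  have hess: "local_hessian g ?w i j x = local_hessian g u i j x / u x
      - pderiv_at i ?w x * pderiv_at j ?w x" for i j
    by (rule local_hessian_ln[OF u _ x]) (rule pos)
  have "local_laplacian g ?w x = (\<Sum>i\<in>UNIV. \<Sum>j\<in>UNIV. matrix_inv (g x) $ i $ j * local_hessian g u j i x / u x
      - matrix_inv (g x) $ i $ j * pderiv_at j ?w x * pderiv_at i ?w x)"
    unfolding local_laplacian_def hess by (simp add: right_diff_distrib mult.assoc)
  also have "\<dots> = local_laplacian g u x / u x
    - (\<Sum>m\<in>UNIV. local_gradient g ?w m x * pderiv_at m ?w x)"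
    by (simp only: sum_subtractf local_laplacian_def local_gradient_def sum_divide_distrib sum_distrib_right)
  finally show ?thesis .
qed

text \<open>Here \<open>\<phi> = a w\<close> with \<open>a = 2 / (n - 2)\<close>, and \<open>f = 2 w = (n - 2) \<phi>\<close>. This proportion makes
  the Hessian of \<open>f\<close> cancel the Hessian of \<open>\<phi>\<close> in the conformal Ricci tensor, as well as the terms
  with \<open>(n - 2) |d\<phi>|\<^sup>2 g\<close>. The coefficients of \<open>dw \<otimes> dw\<close> add up to \<open>2 a - 4 a + a = - a\<close>, and
  \<open>- \<Delta> \<phi> = - a \<Delta> w\<close> splits into the term with \<open>\<Delta> u / u\<close> and \<open>a |dw|\<^sup>2\<close>.\<close>

lemma bakry_emery_local:
  assumes u: "twice_differentiable_on U u" and pos: "\<And>x. x \<in> U \<Longrightarrow> u x > 0" and x: "x \<in> U"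
    and n: "n = real CARD('n)" "n \<ge> 3"
    and ghat: "\<And>y. y \<in> U \<Longrightarrow> ghat y = (u y powr (4 / (n - 2))) *\<^sub>R g y"
  defines "w \<equiv> \<lambda>y. ln (u y)"
  shows "(\<Sum>i\<in>UNIV. riemann ghat i k i j x) + local_hessian ghat (\<lambda>y. 2 * w y) j k x
      - 1 / (4 - n - n) * (pderiv_at j (\<lambda>y. 2 * w y) x * pderiv_at k (\<lambda>y. 2 * w y) x)
    = (\<Sum>i\<in>UNIV. riemann g i k i j x) - 2 * inverse (u x) * local_laplacian g u x / (n - 2) * g x $ j $ k
      + 2 / (n - 2) * ((\<Sum>m\<in>UNIV. local_gradient g w m x * pderiv_at m w x) * g x $ j $ k
                        - pderiv_at j w x * pderiv_at k w x)"
proof -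
  define a where "a = 2 / (n - 2)"
  have w: "twice_differentiable_on U w"
    unfolding w_def by (rule twice_differentiable_ln[OF open_U u pos])
  interpret conformal_change U g "\<lambda>y. a * w y" ghat
  proof
    show "twice_differentiable_on U (\<lambda>y. a * w y)"
      by (rule twice_differentiable_cmult[OF open_U w])
    show "ghat y = exp (2 * (a * w y)) *\<^sub>R g y" if "y \<in> U" for y
      using pos[OF that] by (simp add: ghat[OF that] powr_def a_def w_def)
  qed
  let ?N = "\<Sum>m\<in>UNIV. local_gradient g w m x * pderiv_at m w x"
  note p = pderiv_at_cmult_on(1)[OF open_U w x]
  have N: "(\<Sum>m\<in>UNIV. local_gradient g (\<lambda>y. a * w y) m x * (c * pderiv_at m w x)) = a * c * ?N" for c
    unfolding local_gradient_cmult[OF w x] by (simp add: sum_distrib_left mult_ac)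
  have L: "local_laplacian g w x = local_laplacian g u x / u x - ?N"
    unfolding w_def by (rule local_laplacian_ln[OF u pos x])
  have b: "n - 2 = 2 / a" "1 / (4 - n - n) = - (a / 4)" "a \<noteq> 0"
    using n by (auto simp: a_def field_simps)
  show ?thesis
    unfolding ricci_ghat[OF x] local_hessian_ghat[OF x] p N local_hessian_cmult[OF w x]
      local_laplacian_cmult[OF w x] L n(1)[symmetric] b(1,2)
    using b(3) by (simp add: field_simps)
qed

end

section \<open>Symmetric positive forms\<close>

lemma symmetric_form_commute:
  fixes M :: "real ^ 'n::finite ^ 'n"
  assumes "transpose M = M"
  shows "a \<bullet> (M *v b) = b \<bullet> (M *v a)"
  by (metis assms dot_lmul_matrix inner_commute transpose_matrix_vector)

text \<open>Positivity of the form on \<open>q b - r a\<close>, where \<open>q\<close> is the value of the form on \<open>(a, a)\<close> and \<open>r\<close>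
  its value on \<open>(a, b)\<close>.\<close>

lemma form_Cauchy_Schwarz:
  fixes M :: "real ^ 'n::finite ^ 'n"
  assumes sym: "transpose M = M" and pos: "\<And>\<xi>. \<xi> \<noteq> 0 \<Longrightarrow> \<xi> \<bullet> (M *v \<xi>) > 0"
  shows "(a \<bullet> (M *v b))\<^sup>2 \<le> (a \<bullet> (M *v a)) * (b \<bullet> (M *v b))"
proof (cases "a = 0")
  case False
  define q where "q = a \<bullet> (M *v a)"
  define r where "r = a \<bullet> (M *v b)"
  have q: "q > 0" using pos[OF False] by (simp add: q_def)
  have "0 \<le> (q *\<^sub>R b - r *\<^sub>R a) \<bullet> (M *v (q *\<^sub>R b - r *\<^sub>R a))"
    using pos[of "q *\<^sub>R b - r *\<^sub>R a"] by (cases "q *\<^sub>R b - r *\<^sub>R a = 0") auto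
  also have "\<dots> = q * q * (b \<bullet> (M *v b)) - 2 * (q * (r * r)) + r * r * q"
    using symmetric_form_commute[OF sym, of b a]
    by (simp add: matrix_vector_mult_diff_distrib matrix_vector_mult_scaleR inner_diff_left
        inner_diff_right algebra_simps flip: q_def r_def)
  also have "\<dots> = q * (q * (b \<bullet> (M *v b)) - r\<^sup>2)"
    by (simp add: algebra_simps power2_eq_square)
  finally show ?thesis
    using q by (simp add: zero_le_mult_iff q_def r_def)
qed simp

lemma invertible_positive_form:
  fixes M :: "real ^ 'n::finite ^ 'n"
  assumes "\<And>\<xi>. \<xi> \<noteq> 0 \<Longrightarrow> \<xi> \<bullet> (M *v \<xi>) > 0"
  shows "invertible M"
proof -
  have "\<xi> = 0" if "M *v \<xi> = 0" for \<xi>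
    using assms[of \<xi>] that by force
  then show ?thesis
    using matrix_left_invertible_ker[of M] invertible_left_inverse[of M] by blast
qed

section \<open>Passage to charts\<close>

context riemannian_manifold
begin

lemma chart_inv_coords:
  assumes "c \<in> A" "p \<in> chart_dom c"
  shows "chart_inv c (coords c p) = p"
proof -
  have "topspace (subtopology X (chart_dom c)) = chart_dom c"
    using openin_subset[OF chart_open[OF assms(1)]] by (simp add: Int_absorb1)
  then have "inj_on (coords c) (chart_dom c)"
    using chart_homeo[OF assms(1)] by (simp add: homeomorphic_map_def homeomorphic_eq_everything_map)
  then show ?thesis using assms(2) by (simp add: chart_inv_def)
qed

lemma chart_inv_in_dom:
  "x \<in> coords c ` chart_dom c \<Longrightarrow> chart_inv c x \<in> chart_dom c"
  by (simp add: chart_inv_def inv_into_into)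

lemma invertible_metric: "c \<in> A \<Longrightarrow> p \<in> chart_dom c \<Longrightarrow> invertible (h c p)"
  by (rule invertible_positive_form) (rule metric_pos)

lemma coordinate_metric_chart:
  assumes c: "c \<in> A"
  shows "coordinate_metric (coords c ` chart_dom c) (\<lambda>x. h c (chart_inv c x))"
proof
  let ?U = "coords c ` chart_dom c"
  show U: "open ?U" by (rule chart_image_open[OF c])
  show "invertible (h c (chart_inv c x))" if "x \<in> ?U" for x
    by (rule invertible_metric[OF c chart_inv_in_dom[OF that]])
  show "h c (chart_inv c x) $ i $ j = h c (chart_inv c x) $ j $ i" if "x \<in> ?U" for x i j
    using arg_cong[OF metric_sym[OF c chart_inv_in_dom[OF that]], of "\<lambda>M. M $ j $ i"]
    by (simp add: transpose_def)
  show "twice_differentiable_on ?U (\<lambda>y. h c (chart_inv c y) $ i $ j)" for i j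
    by (rule smooth_on_twice_differentiable[OF metric_smooth[OF c] U, of "\<lambda>M. M $ i $ j"])
      (intro bounded_linear_compose[OF bounded_linear_vec_nth] bounded_linear_vec_nth)
qed

lemma gradient_lowered:
  assumes "c \<in> A" "p \<in> chart_dom c"
  shows "h c p *v gradient h u c p = differential u c p"
  by (simp add: gradient_def matrix_vector_mul_assoc matrix_inv_right_left[OF invertible_metric[OF assms]])

lemma metric_norm_gradient:
  assumes "c \<in> A" "p \<in> chart_dom c"
  shows "(metric_norm h c p (gradient h u c p))\<^sup>2 = gradient h u c p \<bullet> differential u c p"
proof -
  have "0 \<le> gradient h u c p \<bullet> (h c p *v gradient h u c p)"
    using metric_pos[OF assms, of "gradient h u c p"] by (cases "gradient h u c p = 0") auto
  then show ?thesis by (simp add: metric_norm_def gradient_lowered[OF assms])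
qed

text \<open>Since \<open>du(\<xi>)\<close> is the inner product of \<open>\<xi>\<close> with the gradient of \<open>u\<close>, this is the
  Cauchy-Schwarz inequality for the metric.\<close>

lemma differential_squared_le_gradient:
  assumes "c \<in> A" "p \<in> chart_dom c"
  shows "form_le 0 ((metric_norm h c p (gradient h u c p))\<^sup>2 *\<^sub>R h c p
                - tensor_prod (differential u c p) (differential u c p))"
  unfolding form_le_def
proof
  fix \<xi> :: "real ^ 'n"
  let ?d = "differential u c p" and ?G = "gradient h u c p"
  have t: "tensor_prod ?d ?d *v \<xi> = (?d \<bullet> \<xi>) *\<^sub>R ?d"
    by (simp add: vec_eq_iff tensor_prod_def matrix_vector_mult_def inner_vec_def sum_distrib_left mult_ac)
  have "(?d \<bullet> \<xi>)\<^sup>2 \<le> (?G \<bullet> ?d) * (\<xi> \<bullet> (h c p *v \<xi>))"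
    using form_Cauchy_Schwarz[OF metric_sym[OF assms] metric_pos[OF assms], of \<xi> ?G]
    by (simp add: gradient_lowered[OF assms] inner_commute mult.commute)
  then show "\<xi> \<bullet> (0 *v \<xi>) \<le> \<xi> \<bullet> (((metric_norm h c p ?G)\<^sup>2 *\<^sub>R h c p - tensor_prod ?d ?d) *v \<xi>)"
    unfolding metric_norm_gradient[OF assms]
    by (simp add: matrix_vector_mult_diff_rdistrib t
        scaleR_matrix_vector_assoc[symmetric] inner_diff_right power2_eq_square inner_commute)
qed

text \<open>All tensors in the statement are evaluated chartwise, so that their components are those of the
  corresponding local objects of the metric and of \<open>v\<close> in the chart.\<close>

lemma bakry_emery_conformal:
  assumes v: "smooth_function A v" "\<forall>p\<in>topspace X. v p > 0"
    and n: "n = real CARD('n)" "n \<ge> 3" and c: "c \<in> A" and p: "p \<in> chart_dom c"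
  shows "bakry_emery_ricci (4 - n) (conformal_metric (\<lambda>p. v p powr (4 / (n - 2))) h) (\<lambda>p. 2 * ln (v p)) c p
           = ricci h c p
             - (2 * inverse (v p) * laplacian h v c p / (n - 2)) *\<^sub>R h c p
             + (2 / (n - 2)) *\<^sub>R
               ((metric_norm h c p (gradient h (\<lambda>q. ln (v q)) c p))\<^sup>2 *\<^sub>R h c p
                - tensor_prod (differential (\<lambda>q. ln (v q)) c p)
                              (differential (\<lambda>q. ln (v q)) c p))"
proof -
  let ?U = "coords c ` chart_dom c" and ?x = "coords c p" and ?g = "\<lambda>x. h c (chart_inv c x)"
  let ?u = "\<lambda>x. v (chart_inv c x)"
  interpret coordinate_metric ?U ?g by (rule coordinate_metric_chart[OF c])
  have x: "?x \<in> ?U" using p by simp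
  have inv: "chart_inv c ?x = p" by (rule chart_inv_coords[OF c p])
  have u: "twice_differentiable_on ?U ?u"
    using smooth_on_twice_differentiable[OF _ open_U bounded_linear_ident, of "v \<circ> chart_inv c"] v(1) c
    by (simp add: smooth_function_def o_def)
  have pos: "?u y > 0" if "y \<in> ?U" for y
    using v(2) chart_inv_in_dom[OF that] openin_subset[OF chart_open[OF c]] by blast
  have lap: "laplacian h v c p = local_laplacian ?g ?u ?x"
    by (simp add: laplacian_def local_laplacian_def local_hessian_def hessian_def differential_def trace_def
        matrix_matrix_mult_def inv o_def)
  have nrm: "(metric_norm h c p (gradient h (\<lambda>q. ln (v q)) c p))\<^sup>2 =
      (\<Sum>m\<in>UNIV. local_gradient ?g (\<lambda>y. ln (?u y)) m ?x * pderiv_at m (\<lambda>y. ln (?u y)) ?x)"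
    unfolding metric_norm_gradient[OF c p]
    by (simp add: gradient_def local_gradient_def differential_def inner_vec_def
        matrix_vector_mult_def inv o_def)
  show ?thesis
    using bakry_emery_local[OF u pos x n, where ghat = "\<lambda>y. ?u y powr (4 / (n - 2)) *\<^sub>R ?g y"]
    unfolding lap nrm
    by (simp add: vec_eq_iff bakry_emery_ricci_def ricci_def conformal_metric_def hessian_def
        differential_def tensor_prod_def local_hessian_def inv o_def flip: n(1))
qed

end

theorem proposition3p1:
  fixes X :: "'a topology"
    and A :: "('a, 'n::finite) chart set"
    and h hhat :: "('a, 'n) tensor2"
    and v f :: "'a \<Rightarrow> real"
    and n :: real
  assumes "riemannian_manifold X A h"
    and "CARD('n) \<ge> 3"
    and "smooth_function A v"
    and "\<forall>p\<in>topspace X. v p > 0"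
    and n: "n = real CARD('n)"
    and hhat: "hhat = conformal_metric (\<lambda>p. v p powr (4 / (n - 2))) h"
    and f: "f = (\<lambda>p. 2 * ln (v p))"
  shows "(\<forall>c\<in>A. \<forall>p\<in>chart_dom c.
           bakry_emery_ricci (4 - n) hhat f c p
           = ricci h c p
             - (2 * inverse (v p) * laplacian h v c p / (n - 2)) *\<^sub>R h c p
             + (2 / (n - 2)) *\<^sub>R
               ((metric_norm h c p (gradient h (\<lambda>q. ln (v q)) c p))\<^sup>2 *\<^sub>R h c p
                - tensor_prod (differential (\<lambda>q. ln (v q)) c p)
                              (differential (\<lambda>q. ln (v q)) c p)))
       \<and> ((\<forall>c\<in>A. \<forall>p\<in>chart_dom c. form_le 0 (ricci h c p)) \<and>
          (\<forall>c\<in>A. \<forall>p\<in>chart_dom c. laplacian h v c p = 0)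
          \<longrightarrow>
          (\<forall>c\<in>A. \<forall>p\<in>chart_dom c.
             form_le
               ((2 / (n - 2)) *\<^sub>R
                 ((metric_norm h c p (gradient h (\<lambda>q. ln (v q)) c p))\<^sup>2 *\<^sub>R h c p
                  - tensor_prod (differential (\<lambda>q. ln (v q)) c p)
                                (differential (\<lambda>q. ln (v q)) c p)))
               (bakry_emery_ricci (4 - n) hhat f c p)
             \<and> form_le 0
               ((2 / (n - 2)) *\<^sub>R
                 ((metric_norm h c p (gradient h (\<lambda>q. ln (v q)) c p))\<^sup>2 *\<^sub>R h c p
                  - tensor_prod (differential (\<lambda>q. ln (v q)) c p)
                                (differential (\<lambda>q. ln (v q)) c p)))))"
proof -
  interpret riemannian_manifold X A h by fact
  have n3: "n \<ge> 3" using assms(2) n by simp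
  note formula = bakry_emery_conformal[OF assms(3,4) n n3, folded hhat f]
  have scale: "form_le 0 (s *\<^sub>R T)" if "form_le 0 T" "s \<ge> 0" for s and T :: "real ^ 'n ^ 'n"
    using that by (simp add: form_le_def scaleR_matrix_vector_assoc[symmetric])
  have add: "form_le T (S + T)" if "form_le 0 S" for S T :: "real ^ 'n ^ 'n"
    using that by (simp add: form_le_def matrix_vector_mult_add_rdistrib inner_add_right)
  have "0 \<le> 2 / (n - 2)" using n3 by simp
  then show ?thesis
    by (intro conjI impI ballI) (auto simp: formula intro!: add scale[OF differential_squared_le_gradient])
qed

end
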